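(* Let $r>0$, $c>0$, $a>0$ and $b\in\mathbb R$. If $$b_\mu(s)\sim c\,(1/s)^{a}(\log(1/s))^{b}\quad\text{as }s\to0,$$ then $$D_{\mu,r}^{\infty}(R)\sim (b_\mu^{-1}(R))^{r}e^{-R}\sim \left(c^{1/a}a^{-b/a}R^{-1/a}(\log R)^{b/a}\right)^{r}e^{-R}\quad\text{as }R\to\infty.$$
   Context: Standing assumptions: $(E,\|\cdot\|)$ is a real separable Banach space of infinite dimension; $\mu$ is a non-atomic centered Gaussian Borel probability measure on $E$ whose support is all of $E$ (so all moments $\int\|x\|^r d\mu(x)$ are finite). For $a\in E$, $s>0$, $B(a,s)=\{x\in E:\|x-a\|\le s\}$ is the closed ball. The small ball function is $b_\mu(s)=-\log\mu(B(0,s))$, $s>0$ (natural logarithm); it is a continuous, strictly decreasing bijection of $]0,\infty[$ onto $]0,\infty[$, with inverse $b_\mu^{-1}$. A quantizer is a Borel-measurable map $f:E\to E$ whose image $f(E)$ is countable (finite or countably infinite); $\mathcal F$ is the set of all quantizers. $H_\mu^\infty(f) = -\log\big(\max\{\mu(f^{-1}(z)) : z\in f(E)\}\big)$ is the R\'enyi-$\infty$-entropy of $f$, and $D_{\mu,r}(f)=\int_E\|x-f(x)\|^r\,d\mu(x)$. For $R\ge0$, $$D_{\mu,r}^{\infty}(R)=\inf\{D_{\mu,r}(f): f\in\mathcal F,\ H_\mu^\infty(f)\le R\}.$$ Notation: $f\sim g$ as $x\to x_*$ means $\lim_{x\to x_*}f(x)/g(x)=1$. *)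

theory Defs
  imports "HOL-Probability.Probability" "HOL-Library.Landau_Symbols"
begin

text \<open>
  Degenerate one-dimensional marginals (point masses at 0) are Gaussian by convention.
\<close>

definition centered_gaussian :: "'a::real_normed_vector measure \<Rightarrow> bool" where
  "centered_gaussian M \<longleftrightarrow> prob_space M \<and> sets M = sets borel \<and>
     (\<forall>\<phi> :: 'a \<Rightarrow> real. bounded_linear \<phi> \<longrightarrow>
        distr M borel \<phi> = return borel 0 \<or>
        (\<exists>\<sigma>>0. distr M borel \<phi> = density lborel (\<lambda>x. ennreal (normal_density 0 \<sigma> x))))"

definition non_atomic :: "'a measure \<Rightarrow> bool" where
  "non_atomic M \<longleftrightarrow> \<not> (\<exists>A\<in>sets M. emeasure M A > 0 \<and>
     (\<forall>B\<in>sets M. B \<subseteq> A \<longrightarrow> emeasure M B = 0 \<or> emeasure M B = emeasure M A))"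

definition measure_support :: "'a::topological_space measure \<Rightarrow> 'a set" where
  "measure_support M = {x. \<forall>U. open U \<and> x \<in> U \<longrightarrow> emeasure M U > 0}"

definition small_ball :: "'a::real_normed_vector measure \<Rightarrow> real \<Rightarrow> real" where
  "small_ball M s = - ln (measure M (cball 0 s))"

text \<open>
  Inverse of \<^term>\<open>small_ball M\<close> as a function on the positive half-line.
\<close>

definition small_ball_inv :: "'a::real_normed_vector measure \<Rightarrow> real \<Rightarrow> real" where
  "small_ball_inv M = inv_into {0<..} (small_ball M)"

definition quantizers :: "('a::real_normed_vector \<Rightarrow> 'a) set" where
  "quantizers = {f. f \<in> borel_measurable borel \<and> countable (range f)}"

text \<open>
  The range of a quantizer may be infinite, so the maximal cell mass is written as a
  supremum; lemma \<open>quantizer_SUP_attained\<close> shows that it is a maximum.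
\<close>

definition renyi_infinity_entropy :: "'a measure \<Rightarrow> ('a \<Rightarrow> 'a) \<Rightarrow> real" where
  "renyi_infinity_entropy M f = - ln (SUP z\<in>range f. measure M (f -` {z}))"

text \<open>
  The distortion of a quantizer may be infinite, hence the extended nonnegative reals.
\<close>

definition distortion :: "'a::real_normed_vector measure \<Rightarrow> real \<Rightarrow> ('a \<Rightarrow> 'a) \<Rightarrow> ennreal" where
  "distortion M r f = (\<integral>\<^sup>+ x. ennreal (norm (x - f x) powr r) \<partial>M)"

definition optimal_distortion :: "'a::real_normed_vector measure \<Rightarrow> real \<Rightarrow> real \<Rightarrow> ennreal" where
  "optimal_distortion M r R =
     (INF f\<in>{f \<in> quantizers. renyi_infinity_entropy M f \<le> R}. distortion M r f)"

lemma quantizer_SUP_attained: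
  fixes M :: "'a::{real_normed_vector, second_countable_topology} measure"
  assumes "prob_space M" "sets M = sets borel" "f \<in> quantizers"
  shows "\<exists>z\<in>range f. measure M (f -` {z}) > 0 \<and>
           (SUP y\<in>range f. measure M (f -` {y})) = measure M (f -` {z})"
proof -
  interpret prob_space M by fact
  have sp: "space M = UNIV"
    using sets_eq_imp_space_eq[OF assms(2)] by simp
  have f: "f \<in> borel_measurable borel" and cr: "countable (range f)"
    using assms(3) by (auto simp: quantizers_def)
  define p where "p z = measure M (f -` {z})" for z
  have ms: "f -` {z} \<in> sets M" for z
    using measurable_sets[OF f, of "{z}"] assms(2) by simp
  have "\<exists>w\<in>range f. p w > 0"
  proof (rule ccontr)
    assume neg: "\<not> (\<exists>w\<in>range f. p w > 0)"
    have z: "p z = 0" if "z \<in> range f" for z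
      using neg that measure_nonneg[of M "f -` {z}"] unfolding p_def by (metis order_le_less)
    have "(\<Union>z\<in>range f. f -` {z}) \<in> null_sets M"
      using z ms by (intro null_sets_UN' cr) (auto simp: null_sets_def p_def emeasure_eq_measure)
    moreover have "(\<Union>z\<in>range f. f -` {z}) = space M" using sp by auto
    ultimately show False using emeasure_space_1 by (auto simp: null_sets_def)
  qed
  then obtain w where w: "w \<in> range f" "p w > 0" by blast
  define S where "S = {z \<in> range f. p z \<ge> p w}"
  have bound: "real (card T) * p w \<le> 1" if "T \<subseteq> S" "finite T" for T
  proof -
    have "real (card T) * p w \<le> (\<Sum>z\<in>T. p z)"
      using that by (intro sum_bounded_below) (auto simp: S_def)
    also have "\<dots> = measure M (\<Union>z\<in>T. f -` {z})"
      unfolding p_def using that ms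
      by (intro finite_measure_finite_Union[symmetric]) (auto simp: disjoint_family_on_def)
    also have "\<dots> \<le> 1" by (rule prob_le_1)
    finally show ?thesis .
  qed
  have fin: "finite S"
  proof (rule ccontr)
    assume inf: "infinite S"
    obtain n where n: "real n * p w > 1" using reals_Archimedean3[OF w(2)] by blast
    obtain T where T: "T \<subseteq> S" "finite T" "card T = n"
      using infinite_arbitrarily_large[OF inf] by blast
    then show False using bound[of T] n by simp
  qed
  have wS: "w \<in> S" using w by (auto simp: S_def)
  have "Max (p ` S) \<in> p ` S" using fin wS by (intro Max_in) auto
  then obtain z where z: "z \<in> S" "p z = Max (p ` S)" by auto
  have ge: "p y \<le> p z" if "y \<in> range f" for y
  proof (cases "y \<in> S")
    case True then show ?thesis using z(2) fin by simp
  next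
    case False then show ?thesis using that z(1) by (auto simp: S_def)
  qed
  have "(SUP y\<in>range f. p y) = p z"
    using ge z(1) by (intro cSup_eq_maximum) (auto simp: S_def)
  moreover have "p z > 0" using z(1) w(2) by (auto simp: S_def)
  ultimately show ?thesis using z(1) by (auto simp: p_def S_def)
qed

end

theory Submission
  imports Defs "HOL-Real_Asymp.Real_Asymp"
begin

text \<open>
  A cell of mass at least \<open>e\<^sup>-\<^sup>R\<close> is cheapest when it is a ball around the origin. Taking the ball
  of mass exactly \<open>e\<^sup>-\<^sup>R\<close>, whose radius is \<open>s = b\<^sub>\<mu>\<^sup>-\<^sup>1(R)\<close>, as one cell and arbitrarily fine cells
  elsewhere gives \<open>D(R) \<le> s\<^sup>r e\<^sup>-\<^sup>R\<close>. Conversely, by Anderson's inequality a ball of radius \<open>t < s\<close>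
  around the quantization point \<open>z\<close> has mass at most \<open>\<mu>(B(0,t))\<close>, so
  \<open>D(R) \<ge> t\<^sup>r (e\<^sup>-\<^sup>R - \<mu>(B(0,t)))\<close>; for \<open>t = k s\<close> with \<open>k < 1\<close> fixed, regular variation of
  \<open>b\<^sub>\<mu>\<close> makes the subtracted mass negligible.

  Anderson's inequality and the continuity of \<open>b\<^sub>\<mu>\<close> (the existence of a ball of mass exactly \<open>e\<^sup>-\<^sup>R\<close>)
  both follow from \<open>\<mu>(B(x,s)) \<mu>(B(y,t)) \<le> \<mu>(B((x+y)/2,(s+t)/2))\<^sup>2\<close>. Balls are decreasing
  limits of cylinders cut out by a norming sequence of functionals, Gram-Schmidt in \<open>L\<^sup>2(\<mu>)\<close> turns
  cylinders into convex sets under a finite product of standard normals, and there the inequality is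
  the midpoint Prekopa-Leindler inequality, which tensorizes by Fubini.
\<close>

subsection \<open>Midpoint log-concavity of Gaussian product measures\<close>

text \<open>The ball inequality is used at two extremes. With opposite centres and equal radii,
  symmetry makes both factors equal and the square root is Anderson's inequality. With common centre
  0 and unequal radii it forbids a sphere of positive mass; otherwise the distribution function of
  the norm could jump over \<open>exp (- R)\<close> and the upper bound would have no ball of the
  right mass. Everything is kept in midpoint form with a square on the right: weights 1/2 pass
  through Fubini unchanged, and no roots of extended reals occur. The dominating function
  \<open>h\<close>, or set \<open>H\<close>, is an arbitrary measurable one, so the measurability of
  Minkowski sums never arises. Gram-Schmidt yields representations valid only almost everywhere,
  because a functional of zero variance is a null function without being zero. In the lower bound
  \<open>t = s\<close> would give 0. A fixed \<open>k < 1\<close> gives the limiting ratio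
  \<open>k powr r\<close>, and only afterwards is \<open>k\<close> brought close to 1.\<close>

lemma emeasure_lborel_compact_inner:
  fixes A :: "real set"
  assumes A: "A \<in> sets borel"
  shows "emeasure lborel A = (SUP K\<in>{K. K \<subseteq> A \<and> compact K}. emeasure lborel K)"
proof (rule antisym)
  \<comment> \<open>Inner regularity is invoked for finite measures, so \<open>A\<close> is
    exhausted by bounded pieces before compact sets are chosen.\<close>
  have "emeasure lborel A = (SUP n. emeasure lborel (A \<inter> cball 0 (real n)))"
  proof (subst SUP_emeasure_incseq)
    show "range (\<lambda>n. A \<inter> cball 0 (real n)) \<subseteq> sets lborel" using A by auto
    show "incseq (\<lambda>n. A \<inter> cball 0 (real n))" by (auto simp: incseq_def)
    have "(\<Union>n. cball 0 (real n)) = (UNIV :: real set)"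
      by (auto simp: real_arch_simple)
    then show "emeasure lborel A = emeasure lborel (\<Union>n. A \<inter> cball 0 (real n))" by auto
  qed
  also have "\<dots> \<le> (SUP K\<in>{K. K \<subseteq> A \<and> compact K}. emeasure lborel K)"
  proof (rule SUP_least)
    fix n
    define C where "C = cball (0::real) (real n)"
    \<comment> \<open>\<open>N\<close> is Lebesgue measure restricted to the bounded set
      \<open>C\<close>, hence finite.\<close>
    define N where "N = density lborel (indicator C)"
    have N: "emeasure N B = emeasure lborel (C \<inter> B)" if "B \<in> sets borel" for B
      unfolding N_def using that
      by (subst emeasure_density) (auto simp: C_def cball_eq_atLeastAtMost simp flip: indicator_inter_arith)
    have "emeasure N (space N) \<noteq> \<infinity>"
      using N[of UNIV] by (simp add: N_def C_def cball_eq_atLeastAtMost)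
    then have "emeasure N (A \<inter> C) = (SUP K \<in> {K. K \<subseteq> A \<inter> C \<and> compact K}. emeasure N K)"
      using A by (intro inner_regular) (auto simp: N_def C_def)
    also have "\<dots> \<le> (SUP K\<in>{K. K \<subseteq> A \<and> compact K}. emeasure lborel K)"
    proof (rule SUP_mono)
      fix K assume K: "K \<in> {K. K \<subseteq> A \<inter> C \<and> compact K}"
      then have "emeasure N K = emeasure lborel K"
        using N[of K] by (simp add: compact_imp_closed borel_closed Int_absorb1)
      then show "\<exists>m\<in>{K. K \<subseteq> A \<and> compact K}. emeasure N K \<le> emeasure lborel m" using K by auto
    qed
    finally show "emeasure lborel (A \<inter> cball 0 (real n)) \<le> (SUP K\<in>{K. K \<subseteq> A \<and> compact K}. emeasure lborel K)"
      using N[of "A \<inter> C"] A by (simp add: C_def Int_ac)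
  qed
  finally show "emeasure lborel A \<le> (SUP K\<in>{K. K \<subseteq> A \<and> compact K}. emeasure lborel K)" .
  show "(SUP K\<in>{K. K \<subseteq> A \<and> compact K}. emeasure lborel K) \<le> emeasure lborel A"
    using A by (auto intro!: SUP_least emeasure_mono)
qed

text \<open>The set on the right is the midpoint set \<open>(K + l) / 2\<close>, so this is scaling
  by 1/2 followed by translation invariance.\<close>

lemma emeasure_lborel_vimage_half:
  fixes K :: "real set"
  assumes "K \<in> sets borel"
  shows "emeasure lborel K = 2 * emeasure lborel {z. 2 * z - l \<in> K}"
proof -
  have "emeasure lborel K = emeasure (density (distr lborel borel (\<lambda>x. - l + 2 * x)) (\<lambda>_. ennreal \<bar>2\<bar>)) K"
    using lborel_real_affine[of 2 "- l"] by simp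
  also have "\<dots> = 2 * emeasure (distr lborel borel (\<lambda>x. - l + 2 * x)) K"
    using assms by (subst emeasure_density) (auto simp: nn_integral_cmult)
  also have "emeasure (distr lborel borel (\<lambda>x. - l + 2 * x)) K = emeasure lborel {z. 2 * z - l \<in> K}"
    using assms by (subst emeasure_distr) (auto simp: vimage_def algebra_simps)
  finally show ?thesis .
qed

text \<open>Let \<open>k\<close> be the maximum of \<open>K\<close> and \<open>l\<close> the minimum
  of \<open>L\<close>. The midpoint sets \<open>(K + l) / 2\<close> and \<open>(L + k) / 2\<close>
  both lie in \<open>H\<close>; the former is to the left of \<open>(k + l) / 2\<close> and the
  latter to the right, so they overlap in at most one point and their measures add up.\<close>

lemma brunn_minkowski_real_compact:
  fixes K L H :: "real set"
  assumes K: "compact K" "K \<noteq> {}" and L: "compact L" "L \<noteq> {}" and H: "H \<in> sets borel"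
    and KLH: "\<And>x y. x \<in> K \<Longrightarrow> y \<in> L \<Longrightarrow> (x + y) / 2 \<in> H"
  shows "emeasure lborel K + emeasure lborel L \<le> 2 * emeasure lborel H"
proof -
  obtain k where k: "k \<in> K" "\<And>x. x \<in> K \<Longrightarrow> x \<le> k" using compact_attains_sup[OF K] by auto
  obtain l where l: "l \<in> L" "\<And>x. x \<in> L \<Longrightarrow> l \<le> x" using compact_attains_inf[OF L] by auto
  define K' where "K' = {z. 2 * z - l \<in> K}"
  define L' where "L' = {z. 2 * z - k \<in> L}"
  have KL[measurable]: "K \<in> sets borel" "L \<in> sets borel"
    using K L by (auto simp: compact_imp_closed)
  have [measurable]: "K' \<in> sets borel" "L' \<in> sets borel"
    unfolding K'_def L'_def by measurable
  have sub: "K' \<union> L' \<subseteq> H"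
    using KLH[OF _ l(1)] KLH[OF k(1)] by (force simp: K'_def L'_def)
  have "K' \<inter> L' \<subseteq> {(k + l) / 2}"
    using k(2) l(2) by (force simp: K'_def L'_def)
  then have "K' \<inter> L' \<in> null_sets lborel"
    by (intro countable_imp_null_set_lborel countable_finite) (auto dest: finite_subset)
  then have "emeasure lborel K' + emeasure lborel L' = emeasure lborel (K' \<union> L')"
    using emeasure_Un_Int[of K' lborel L'] by (auto simp: null_sets_def)
  also have "\<dots> \<le> emeasure lborel H" using sub H by (intro emeasure_mono) auto
  finally have "2 * (emeasure lborel K' + emeasure lborel L') \<le> 2 * emeasure lborel H"
    by (rule mult_left_mono) simp
  then show ?thesis
    using emeasure_lborel_vimage_half[OF KL(1), of l] emeasure_lborel_vimage_half[OF KL(2), of k]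
    by (simp add: K'_def L'_def distrib_left)
qed

lemma brunn_minkowski_real:
  fixes A B H :: "real set"
  assumes A: "A \<in> sets borel" "A \<noteq> {}" and B: "B \<in> sets borel" "B \<noteq> {}" and H: "H \<in> sets borel"
    and ABH: "\<And>x y. x \<in> A \<Longrightarrow> y \<in> B \<Longrightarrow> (x + y) / 2 \<in> H"
  shows "emeasure lborel A + emeasure lborel B \<le> 2 * emeasure lborel H"
proof -
  obtain a b where ab: "a \<in> A" "b \<in> B" using A B by auto
  have *: "emeasure lborel K + emeasure lborel L \<le> 2 * emeasure lborel H"
    if "K \<subseteq> A" "compact K" "L \<subseteq> B" "compact L" for K L
  proof -
    \<comment> \<open>The approximating compact sets may be empty, while the compact case needs
      extreme points; inserting \<open>a\<close> and \<open>b\<close> keeps them inside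
      \<open>A\<close> and \<open>B\<close> and makes them nonempty.\<close>
    have "emeasure lborel K + emeasure lborel L \<le> emeasure lborel (insert a K) + emeasure lborel (insert b L)"
      using that by (intro add_mono emeasure_mono) (auto simp: compact_imp_closed)
    also have "\<dots> \<le> 2 * emeasure lborel H"
      using that ab H by (intro brunn_minkowski_real_compact ABH) auto
    finally show ?thesis .
  qed
  have ne: "{K. K \<subseteq> A \<and> compact K} \<noteq> {}" "{K. K \<subseteq> B \<and> compact K} \<noteq> {}"
    by (auto intro!: exI[of _ "{}"])
  show ?thesis
    unfolding emeasure_lborel_compact_inner[OF A(1)] emeasure_lborel_compact_inner[OF B(1)]
      ennreal_SUP_add_left[OF ne(1), symmetric]
  proof (rule SUP_least)
    fix K assume K: "K \<in> {K. K \<subseteq> A \<and> compact K}"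
    have "emeasure lborel K + (SUP L\<in>{L. L \<subseteq> B \<and> compact L}. emeasure lborel L)
        = (SUP L\<in>{L. L \<subseteq> B \<and> compact L}. emeasure lborel K + emeasure lborel L)"
      using ne by (intro ennreal_SUP_add_right) auto
    also have "\<dots> \<le> 2 * emeasure lborel H" using K * by (auto intro!: SUP_least)
    finally show "emeasure lborel K + (SUP L\<in>{L. L \<subseteq> B \<and> compact L}. emeasure lborel L) \<le> 2 * emeasure lborel H" .
  qed
qed

section \<open>The Prekopa-Leindler inequality, from the line to finite products\<close>

lemma nn_integral_layer_cake:
  fixes f :: "real \<Rightarrow> ennreal"
  assumes [measurable]: "f \<in> borel_measurable borel"
  shows "(\<integral>\<^sup>+x. min (f x) 1 \<partial>lborel) = 
     (\<integral>\<^sup>+s. emeasure lborel {x. ennreal s < f x} * indicator {0..<1} s \<partial>lborel)"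
proof -
  have "min (f x) 1 = (\<integral>\<^sup>+s. indicator {s. ennreal s < f x} s * indicator {0..<1} s \<partial>lborel)" for x
  proof -
    define m where "m = enn2real (min (f x) 1)"
    have m: "min (f x) 1 = ennreal m" "0 \<le> m" unfolding m_def by (auto simp: min_def ennreal_enn2real_if top_unique)
    have "ennreal s < f x \<longleftrightarrow> s < m" if "0 \<le> s" "s < 1" for s
    proof -
      have "ennreal s < f x \<longleftrightarrow> ennreal s < min (f x) 1" using that by (auto simp: ennreal_less_one_iff)
      then show ?thesis using that m by (simp add: ennreal_less_iff)
    qed
    moreover have "m \<le> 1" unfolding m_def by (simp add: enn2real_leI)
    ultimately have "{s. ennreal s < f x} \<inter> {0..<1} = {0..<m}" by auto
    then show ?thesis using m by (simp flip: indicator_inter_arith)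
  qed
  then have "(\<integral>\<^sup>+x. min (f x) 1 \<partial>lborel) =
      (\<integral>\<^sup>+x. \<integral>\<^sup>+s. indicator {s. ennreal s < f x} s * indicator {0..<1} s \<partial>lborel \<partial>lborel)" by simp
  also have "\<dots> = (\<integral>\<^sup>+s. \<integral>\<^sup>+x. indicator {s. ennreal s < f x} s * indicator {0..<1} s \<partial>lborel \<partial>lborel)"
    by (rule lborel_pair.Fubini') measurable
  also have "\<dots> = (\<integral>\<^sup>+s. emeasure lborel {x. ennreal s < f x} * indicator {0..<1} s \<partial>lborel)"
  proof (rule nn_integral_cong)
    fix s :: real
    have "(\<integral>\<^sup>+x. indicator {s. ennreal s < f x} s * indicator {0..<1} s \<partial>lborel) =
       (\<integral>\<^sup>+x. indicator {x. ennreal s < f x} x * indicator {0..<1} s \<partial>lborel)"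
      by (intro nn_integral_cong) (auto simp: indicator_def)
    also have "\<dots> = emeasure lborel {x. ennreal s < f x} * indicator {0..<1} s"
      by (subst nn_integral_multc) auto
    finally show "(\<integral>\<^sup>+x. indicator {s. ennreal s < f x} s * indicator {0..<1} s \<partial>lborel) = emeasure lborel {x. ennreal s < f x} * indicator {0..<1} s" .
  qed
  finally show ?thesis .
qed

lemma ennreal_amgm:
  fixes x y z :: ennreal
  assumes "x + y \<le> 2 * z"
  shows "x * y \<le> z\<^sup>2"
proof (cases "z = top")
  case False
  then obtain c where c: "z = ennreal c" "0 \<le> c" by (cases z) auto
  have "x + y \<le> ennreal (2 * c)" using assms c by (simp add: ennreal_mult)
  then obtain a b where ab: "x = ennreal a" "0 \<le> a" "y = ennreal b" "0 \<le> b"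
    by (cases x; cases y) (auto simp: top_unique)
  have le: "a + b \<le> 2 * c" using \<open>x + y \<le> ennreal (2 * c)\<close> ab c
    by (simp flip: ennreal_plus)
  have "4 * (a * b) \<le> (a + b)\<^sup>2" using zero_le_power2[of "a - b"] by (simp add: power2_eq_square algebra_simps)
  also have "\<dots> \<le> (2 * c)\<^sup>2" using le ab by (intro power_mono) auto
  finally have "a * b \<le> c\<^sup>2" by simp
  then show ?thesis using ab c by (simp add: ennreal_power flip: ennreal_mult)
qed (simp add: power2_eq_square ennreal_top_mult)

text \<open>Where \<open>f\<close> and \<open>g\<close> exceed a level \<open>s\<close>,
  \<open>h\<close> exceeds \<open>s\<close> at the midpoint, so Brunn-Minkowski compares the level
  sets. It needs nonempty sets, which holds for all \<open>s < 1\<close> exactly because both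
  suprema equal 1. Integrating over these levels loses nothing for \<open>f\<close> and
  \<open>g\<close> and truncates \<open>h\<close> at 1, which only decreases the right-hand
  side.\<close>

lemma prekopa_leindler_real_normalized:
  fixes f g h :: "real \<Rightarrow> ennreal"
  assumes [measurable]: "f \<in> borel_measurable borel" "g \<in> borel_measurable borel" "h \<in> borel_measurable borel"
    and sup: "(SUP x. f x) = 1" "(SUP x. g x) = 1"
    and fgh: "\<And>x y. f x * g y \<le> (h ((x + y) / 2))\<^sup>2"
  shows "(\<integral>\<^sup>+x. f x \<partial>lborel) + (\<integral>\<^sup>+x. g x \<partial>lborel) \<le> 2 * (\<integral>\<^sup>+x. h x \<partial>lborel)"
proof -
  have le1: "f x \<le> 1" "g x \<le> 1" for x
    using SUP_upper[of x UNIV f] SUP_upper[of x UNIV g] sup by auto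
  have bm: "emeasure lborel {x. ennreal s < f x} + emeasure lborel {x. ennreal s < g x}
      \<le> 2 * emeasure lborel {x. ennreal s < h x}" if s: "0 \<le> s" "s < 1" for s
  proof (rule brunn_minkowski_real)
    have "ennreal s < (SUP x. f x)" "ennreal s < (SUP x. g x)"
      using s sup by (auto simp: ennreal_less_one_iff)
    then show "{x. ennreal s < f x} \<noteq> {}" "{x. ennreal s < g x} \<noteq> {}"
      by (auto simp: less_SUP_iff)
    fix x y assume "x \<in> {x. ennreal s < f x}" "y \<in> {x. ennreal s < g x}"
    then have xy: "ennreal s < f x" "ennreal s < g y" by auto
    obtain a b where ab: "f x = ennreal a" "0 \<le> a" "g y = ennreal b" "0 \<le> b"
      using le1(1)[of x] le1(2)[of y] by (cases "f x"; cases "g y") (auto simp: top_unique)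
    have "s * s < a * b" using xy ab s by (intro mult_strict_mono) (auto simp: ennreal_less_iff)
    then have "(ennreal s)\<^sup>2 < f x * g y"
      using s ab by (simp add: power2_eq_square ennreal_less_iff flip: ennreal_mult)
    also have "\<dots> \<le> (h ((x + y) / 2))\<^sup>2" by (rule fgh)
    finally have "ennreal s < h ((x + y) / 2)"
      by (metis linorder_not_less power_mono zero_le)
    then show "(x + y) / 2 \<in> {x. ennreal s < h x}" by simp
  qed auto
  have "(\<integral>\<^sup>+x. f x \<partial>lborel) + (\<integral>\<^sup>+x. g x \<partial>lborel)
      = (\<integral>\<^sup>+x. min (f x) 1 \<partial>lborel) + (\<integral>\<^sup>+x. min (g x) 1 \<partial>lborel)"
    using le1 by (simp add: min_absorb1)
  also have "\<dots> = (\<integral>\<^sup>+s. (emeasure lborel {x. ennreal s < f x} + emeasure lborel {x. ennreal s < g x}) * indicator {0..<1} s \<partial>lborel)"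
    unfolding nn_integral_layer_cake[OF assms(1)] nn_integral_layer_cake[OF assms(2)]
    by (subst nn_integral_add[symmetric]) (auto simp: distrib_right)
  also have "\<dots> \<le> (\<integral>\<^sup>+s. 2 * (emeasure lborel {x. ennreal s < h x} * indicator {0..<1} s) \<partial>lborel)"
    using bm by (intro nn_integral_mono) (auto simp: indicator_def)
  also have "\<dots> = 2 * (\<integral>\<^sup>+x. min (h x) 1 \<partial>lborel)"
    unfolding nn_integral_layer_cake[OF assms(3)] by (rule nn_integral_cmult) measurable
  also have "\<dots> \<le> 2 * (\<integral>\<^sup>+x. h x \<partial>lborel)"
    by (intro mult_left_mono nn_integral_mono) auto
  finally show ?thesis .
qed

text \<open>The inequality is homogeneous: dividing \<open>f\<close>, \<open>g\<close>,
  \<open>h\<close> by \<alpha>, \<beta> and the geometric mean \<gamma> of the two suprema preserves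
  the pointwise hypothesis and normalizes the suprema to 1. The additive inequality then becomes
  multiplicative by the inequality between arithmetic and geometric means. The bound
  \<open>C\<close> keeps \<alpha> and \<beta> finite.\<close>

lemma prekopa_leindler_real:
  fixes f g h :: "real \<Rightarrow> ennreal"
  assumes [measurable]: "f \<in> borel_measurable borel" "g \<in> borel_measurable borel" "h \<in> borel_measurable borel"
    and bd: "\<And>x. f x \<le> ennreal C" "\<And>x. g x \<le> ennreal C"
    and fgh: "\<And>x y. f x * g y \<le> (h ((x + y) / 2))\<^sup>2"
  shows "(\<integral>\<^sup>+x. f x \<partial>lborel) * (\<integral>\<^sup>+x. g x \<partial>lborel) \<le> (\<integral>\<^sup>+x. h x \<partial>lborel)\<^sup>2"
proof (cases "(\<forall>x. f x = 0) \<or> (\<forall>x. g x = 0)")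
  case False
  have "(SUP x. f x) \<le> ennreal C" "(SUP x. g x) \<le> ennreal C"
    using bd by (auto intro: SUP_least)
  then obtain \<alpha> \<beta> where ab: "(SUP x. f x) = ennreal \<alpha>" "0 \<le> \<alpha>" "(SUP x. g x) = ennreal \<beta>" "0 \<le> \<beta>"
    by (cases "SUP x. f x"; cases "SUP x. g x") (auto simp: top_unique)
  have "\<alpha> \<noteq> 0" "\<beta> \<noteq> 0"
    using False SUP_upper[of _ UNIV f] SUP_upper[of _ UNIV g] ab
    by (metis ennreal_0 iso_tuple_UNIV_I le_zero_eq)+
  then have pos: "0 < \<alpha>" "0 < \<beta>" using ab by auto
  define \<gamma> where "\<gamma> = sqrt (\<alpha> * \<beta>)"
  have g: "0 < \<gamma>" "\<gamma> * \<gamma> = \<alpha> * \<beta>" using pos by (auto simp: \<gamma>_def)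
  have gg: "ennreal (1 / (\<alpha> * \<beta>)) = (ennreal (1 / \<gamma>))\<^sup>2"
    using g by (simp add: power2_eq_square flip: ennreal_mult)
  have gg': "ennreal \<alpha> * ennreal \<beta> = (ennreal \<gamma>)\<^sup>2"
    using g ab by (simp add: power2_eq_square flip: ennreal_mult)
  define f' g' h' where "f' x = ennreal (1 / \<alpha>) * f x" and "g' x = ennreal (1 / \<beta>) * g x"
    and "h' x = ennreal (1 / \<gamma>) * h x" for x
  have eqs: "f x = ennreal \<alpha> * f' x" "g x = ennreal \<beta> * g' x" "h x = ennreal \<gamma> * h' x" for x
    using pos g(1) by (simp_all add: f'_def g'_def h'_def mult.assoc[symmetric] flip: ennreal_mult)
  have [measurable]: "f' \<in> borel_measurable borel" "g' \<in> borel_measurable borel" "h' \<in> borel_measurable borel"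
    unfolding f'_def g'_def h'_def by measurable
  have "(\<integral>\<^sup>+x. f' x \<partial>lborel) + (\<integral>\<^sup>+x. g' x \<partial>lborel) \<le> 2 * (\<integral>\<^sup>+x. h' x \<partial>lborel)"
  proof (rule prekopa_leindler_real_normalized)
    show "(SUP x. f' x) = 1" "(SUP x. g' x) = 1"
      unfolding f'_def g'_def using ab pos
      by (simp_all add: SUP_mult_left_ennreal[symmetric] flip: ennreal_mult)
    fix x y
    have "f' x * g' y = ennreal (1 / (\<alpha> * \<beta>)) * (f x * g y)"
      using pos by (simp add: f'_def g'_def mult_ac ennreal_mult[symmetric] flip: mult.assoc)
    also have "\<dots> \<le> ennreal (1 / (\<alpha> * \<beta>)) * (h ((x + y) / 2))\<^sup>2"
      by (intro mult_left_mono fgh) auto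
    also have "\<dots> = (h' ((x + y) / 2))\<^sup>2"
      unfolding gg h'_def power_mult_distrib ..
    finally show "f' x * g' y \<le> (h' ((x + y) / 2))\<^sup>2" .
  qed auto
  then have *: "(\<integral>\<^sup>+x. f' x \<partial>lborel) * (\<integral>\<^sup>+x. g' x \<partial>lborel) \<le> (\<integral>\<^sup>+x. h' x \<partial>lborel)\<^sup>2"
    by (rule ennreal_amgm)
  have "(\<integral>\<^sup>+x. f x \<partial>lborel) * (\<integral>\<^sup>+x. g x \<partial>lborel) =
      ennreal \<alpha> * ennreal \<beta> * ((\<integral>\<^sup>+x. f' x \<partial>lborel) * (\<integral>\<^sup>+x. g' x \<partial>lborel))"
    unfolding eqs by (simp add: nn_integral_cmult mult_ac)
  also have "\<dots> \<le> ennreal \<alpha> * ennreal \<beta> * (\<integral>\<^sup>+x. h' x \<partial>lborel)\<^sup>2"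
    by (intro mult_left_mono *) auto
  also have "\<dots> = (\<integral>\<^sup>+x. h x \<partial>lborel)\<^sup>2"
    unfolding eqs gg' by (simp add: nn_integral_cmult power_mult_distrib)
  finally show ?thesis .
qed auto

text \<open>The normal density is itself midpoint log-concave, by convexity of the square, so
  multiplying \<open>f\<close>, \<open>g\<close> and \<open>h\<close> by it preserves the pointwise
  hypothesis and reduces the claim to Lebesgue measure.\<close>

lemma prekopa_leindler_std_normal:
  fixes f g h :: "real \<Rightarrow> ennreal"
  assumes [measurable]: "f \<in> borel_measurable borel" "g \<in> borel_measurable borel" "h \<in> borel_measurable borel"
    and bd: "\<And>x. f x \<le> 1" "\<And>x. g x \<le> 1"
    and fgh: "\<And>x y. f x * g y \<le> (h ((x + y) / 2))\<^sup>2"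
  shows "(\<integral>\<^sup>+x. f x \<partial>std_normal_distribution) * (\<integral>\<^sup>+x. g x \<partial>std_normal_distribution)
     \<le> (\<integral>\<^sup>+x. h x \<partial>std_normal_distribution)\<^sup>2"
proof -
  define p where "p = std_normal_density"
  have p1: "0 \<le> p x" "p x \<le> 1" for x
  proof -
    have "1 / sqrt (2 * pi) \<le> 1" using pi_ge_two by (simp add: real_le_rsqrt)
    then show "p x \<le> 1" unfolding p_def std_normal_density_def by (intro mult_le_one) auto
  qed (simp add: p_def)
  have pp: "p x * p y \<le> (p ((x + y) / 2))\<^sup>2" for x y
  proof -
    have "- x\<^sup>2 / 2 + - y\<^sup>2 / 2 \<le> 2 * (- ((x + y) / 2)\<^sup>2 / 2)"
      using zero_le_power2[of "x - y"] by (simp add: power2_eq_square field_simps)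
    then have "exp (- x\<^sup>2 / 2) * exp (- y\<^sup>2 / 2) \<le> (exp (- ((x + y) / 2)\<^sup>2 / 2))\<^sup>2"
      by (simp add: exp_double[symmetric] flip: exp_add)
    then have "(1 / sqrt (2 * pi))\<^sup>2 * (exp (- x\<^sup>2 / 2) * exp (- y\<^sup>2 / 2)) \<le> (1 / sqrt (2 * pi))\<^sup>2 * (exp (- ((x + y) / 2)\<^sup>2 / 2))\<^sup>2"
      by (rule mult_left_mono) auto
    then show ?thesis unfolding p_def std_normal_density_def power_mult_distrib
      by (simp add: power2_eq_square mult_ac)
  qed
  have [measurable]: "p \<in> borel_measurable borel" by (simp add: p_def)
  have d: "(\<integral>\<^sup>+x. u x \<partial>std_normal_distribution) = (\<integral>\<^sup>+x. ennreal (p x) * u x \<partial>lborel)"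
    if "u \<in> borel_measurable borel" for u
    using that by (simp add: nn_integral_density p_def)
  show ?thesis
    unfolding d[OF assms(1)] d[OF assms(2)] d[OF assms(3)]
  proof (rule prekopa_leindler_real[where C = 1])
    fix x y
    show "ennreal (p x) * f x \<le> ennreal 1" "ennreal (p x) * g x \<le> ennreal 1"
      using mult_mono[of "ennreal (p x)" 1 "f x" 1] mult_mono[of "ennreal (p x)" 1 "g x" 1] bd[of x] p1[of x] by auto
    have "ennreal (p x) * f x * (ennreal (p y) * g y) = ennreal (p x * p y) * (f x * g y)"
      using p1 by (simp add: ennreal_mult mult_ac)
    also have "\<dots> \<le> ennreal ((p ((x + y) / 2))\<^sup>2) * (h ((x + y) / 2))\<^sup>2"
      by (intro mult_mono ennreal_leI pp fgh) auto
    also have "\<dots> = (ennreal (p ((x + y) / 2)) * h ((x + y) / 2))\<^sup>2"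
      using p1 by (simp add: power_mult_distrib ennreal_power)
    finally show "ennreal (p x) * f x * (ennreal (p y) * g y) \<le> (ennreal (p ((x + y) / 2)) * h ((x + y) / 2))\<^sup>2" .
  qed auto
qed

text \<open>Integrating out the new coordinate turns the one-dimensional inequality into the
  pointwise hypothesis for the remaining coordinates. The bound 1 survives this because the factors
  are probability measures.\<close>

lemma prekopa_leindler_PiM_std_normal:
  fixes f g h :: "('i \<Rightarrow> real) \<Rightarrow> ennreal"
  defines "P \<equiv> \<lambda>I :: 'i set. PiM I (\<lambda>_. std_normal_distribution)"
  assumes "finite I"
    and "f \<in> borel_measurable (P I)" "g \<in> borel_measurable (P I)" "h \<in> borel_measurable (P I)"
    and "\<And>x. x \<in> space (P I) \<Longrightarrow> f x \<le> 1" "\<And>x. x \<in> space (P I) \<Longrightarrow> g x \<le> 1"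
    and "\<And>x y. x \<in> space (P I) \<Longrightarrow> y \<in> space (P I) \<Longrightarrow> f x * g y \<le> (h (\<lambda>i\<in>I. (x i + y i) / 2))\<^sup>2"
  shows "(\<integral>\<^sup>+x. f x \<partial>P I) * (\<integral>\<^sup>+x. g x \<partial>P I) \<le> (\<integral>\<^sup>+x. h x \<partial>P I)\<^sup>2"
  using assms(2-)
proof (induction I arbitrary: f g h rule: finite_induct)
  interpret S: prob_space std_normal_distribution by (rule prob_space_normal_density) simp
  interpret product_sigma_finite "\<lambda>_::'i. std_normal_distribution" ..
  {
    case empty
    \<comment> \<open>The empty product space consists of the single function that is
      \<open>undefined\<close> everywhere, so the integrals are values at this point.\<close>
    from empty(6)[of "\<lambda>_. undefined" "\<lambda>_. undefined"] show ?case
      by (simp add: P_def space_PiM_empty nn_integral_empty)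
  next
    case (insert i I)
    interpret PI: prob_space "P I" unfolding P_def by (rule prob_space_PiM) (rule S.prob_space_axioms)
    have sp: "x(i := y) \<in> space (P (insert i I))" if "x \<in> space (P I)" for x y
      using that by (auto simp: P_def space_PiM PiE_iff extensional_def)
    note [measurable] = insert.prems(1-3)[unfolded P_def]
    have m: "(\<lambda>(x, y). u (x(i := y))) \<in> borel_measurable (P I \<Otimes>\<^sub>M std_normal_distribution)"
      if "u \<in> borel_measurable (P (insert i I))" for u :: "('i \<Rightarrow> real) \<Rightarrow> ennreal"
    proof -
      have "(\<lambda>(x, y). x(i := y)) \<in> measurable (P I \<Otimes>\<^sub>M std_normal_distribution) (P (insert i I))"
        unfolding P_def by (rule measurable_add_dim)
      from measurable_compose[OF this that] show ?thesis by (simp add: case_prod_beta)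
    qed
    note m' = m[OF insert.prems(1)] m[OF insert.prems(2)] m[OF insert.prems(3)]
    have sec: "(\<lambda>y. u (x(i := y))) \<in> borel_measurable borel"
      if "u \<in> borel_measurable (P (insert i I))" "x \<in> space (P I)" for u :: "('i \<Rightarrow> real) \<Rightarrow> ennreal" and x
      using measurable_Pair2[OF m[OF that(1)] that(2)] by simp
    have ins: "(\<integral>\<^sup>+x. u x \<partial>P (insert i I)) = (\<integral>\<^sup>+x. (\<integral>\<^sup>+y. u (x(i := y)) \<partial>std_normal_distribution) \<partial>P I)"
      if "u \<in> borel_measurable (P (insert i I))" for u :: "('i \<Rightarrow> real) \<Rightarrow> ennreal"
      using that insert.hyps unfolding P_def by (intro product_nn_integral_insert) auto
    have ae1: "(\<integral>\<^sup>+y. u y \<partial>std_normal_distribution) \<le> 1" if "\<And>y. u y \<le> 1" for u :: "real \<Rightarrow> ennreal"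
      using nn_integral_mono[of std_normal_distribution u "\<lambda>_. 1"] that S.emeasure_space_1 by simp
    show ?case
      unfolding ins[OF insert.prems(1)] ins[OF insert.prems(2)] ins[OF insert.prems(3)]
    proof (rule insert.IH)
      fix x y assume xy: "x \<in> space (P I)" "y \<in> space (P I)"
      define z where "z = (\<lambda>i\<in>I. (x i + y i) / 2)"
      have z: "z \<in> space (P I)" by (simp add: z_def P_def space_PiM)
      show "(\<integral>\<^sup>+t. f (x(i := t)) \<partial>std_normal_distribution) * (\<integral>\<^sup>+t. g (y(i := t)) \<partial>std_normal_distribution)
         \<le> (\<integral>\<^sup>+t. h (z(i := t)) \<partial>std_normal_distribution)\<^sup>2"
      proof (rule prekopa_leindler_std_normal)
        fix s t :: real
        have "(\<lambda>j\<in>insert i I. ((x(i := s)) j + (y(i := t)) j) / 2) = z(i := (s + t) / 2)"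
          using insert.hyps by (auto simp: z_def fun_eq_iff)
        then show "f (x(i := s)) * g (y(i := t)) \<le> (h (z(i := (s + t) / 2)))\<^sup>2"
          using insert.prems(6)[OF sp[OF xy(1)] sp[OF xy(2)], of s t] by (simp only:)
        show "f (x(i := s)) \<le> 1" "g (y(i := s)) \<le> 1"
          by (intro insert.prems(4,5) sp xy)+
      qed (intro sec insert.prems(1-3) xy z)+
    next
      fix x assume "x \<in> space (P I)"
      then show "(\<integral>\<^sup>+t. f (x(i := t)) \<partial>std_normal_distribution) \<le> 1" "(\<integral>\<^sup>+t. g (x(i := t)) \<partial>std_normal_distribution) \<le> 1"
        by (intro ae1 insert.prems(4,5) sp, assumption)+
    qed (intro S.borel_measurable_nn_integral m')+
  }
qed

subsection \<open>Independence from characteristic functions\<close>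

lemma real_distribution_std_normal: "real_distribution std_normal_distribution"
  by (intro real_distribution.intro real_distribution_axioms.intro prob_space_normal_density) auto

lemma (in prob_space) std_normal_distr_if_char:
  assumes Y[measurable]: "Y \<in> borel_measurable M"
    and ch: "\<And>t. (\<integral>x. iexp (t * Y x) \<partial>M) = complex_of_real (exp (- (t\<^sup>2) / 2))"
  shows "distr M borel Y = std_normal_distribution"
proof (rule Levy_uniqueness)
  show "real_distribution (distr M borel Y)" by (rule real_distribution_distr) fact
  show "char (distr M borel Y) = char std_normal_distribution"
    unfolding char_std_normal_distribution using ch by (auto simp: fun_eq_iff char_def integral_distr)
qed (rule real_distribution_std_normal)

text \<open>
  A bounded weight \<open>V\<close> becomes a probability density after adding 2 and normalizing, so that
  Levy's uniqueness theorem applies to the law of \<open>Y\<close> under the weighted measure.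
\<close>

lemma (in prob_space) real_weight_indicator_std_normal:
  fixes V Y :: "'a \<Rightarrow> real"
  assumes [measurable]: "V \<in> borel_measurable M" "Y \<in> borel_measurable M" "A \<in> sets borel"
    and V: "\<And>x. \<bar>V x\<bar> \<le> 1"
    and ch: "\<And>t. (\<integral>x. V x * iexp (t * Y x) \<partial>M) = v * complex_of_real (exp (- (t\<^sup>2) / 2))"
    and one: "\<And>t. (\<integral>x. iexp (t * Y x) \<partial>M) = complex_of_real (exp (- (t\<^sup>2) / 2))"
  shows "(\<integral>x. V x * indicator A (Y x) \<partial>M) = v * measure std_normal_distribution A"
proof -
  have iV[simp]: "integrable M V" by (rule integrable_const_bound[where B=1]) (use V in auto)
  \<comment> \<open>Frequency 0 identifies \<open>v\<close> as the mean of \<open>V\<close>, so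
    \<open>2 + v\<close> is the total mass of the weight \<open>2 + V\<close>.\<close>
  have "complex_of_real (\<integral>x. V x \<partial>M) = complex_of_real v" using ch[of 0] by simp
  then have v: "(\<integral>x. V x \<partial>M) = v" by (simp only: of_real_eq_iff)
  have "\<bar>v\<bar> \<le> 1"
  proof -
    have "(\<integral>x. V x \<partial>M) \<le> (\<integral>x. 1 \<partial>M)" "(\<integral>x. -1 \<partial>M) \<le> (\<integral>x. V x \<partial>M)"
      by (intro integral_mono; use V in \<open>auto simp: abs_le_iff minus_le_iff\<close>)+
    then show ?thesis by (simp add: v prob_space)
  qed
  then have v2: "0 < 2 + v" by linarith
  have V2: "0 \<le> 2 + V x" for x using V[of x] by linarith
  define D where "D = density M (\<lambda>x. ennreal ((2 + V x) / (2 + v)))"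
  have [measurable]: "Y \<in> borel_measurable D" by (simp add: D_def)
  have Dint: "(\<integral>x. u x \<partial>D) = (\<integral>x. ((2 + V x) / (2 + v)) *\<^sub>R u x \<partial>M)"
    if "u \<in> borel_measurable M" for u :: "'a \<Rightarrow> 'b::{banach, second_countable_topology}"
    unfolding D_def using that V2 v2 by (intro integral_density) auto
  have "prob_space D"
  proof
    have "emeasure D (space D) = (\<integral>\<^sup>+x. ennreal ((2 + V x) / (2 + v)) \<partial>M)"
      by (simp add: D_def emeasure_density cong: nn_integral_cong)
    also have "\<dots> = ennreal (\<integral>x. (2 + V x) / (2 + v) \<partial>M)"
      using V2 v2 by (intro nn_integral_eq_integral) auto
    also have "(\<integral>x. (2 + V x) / (2 + v) \<partial>M) = 1"
      using v2 v by (simp add: prob_space)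
    finally show "emeasure D (space D) = 1" by simp
  qed
  then interpret D: prob_space D .
  have iY: "integrable M (\<lambda>x. iexp (t * Y x))" for t
    by (rule integrable_const_bound[where B=1]) auto
  have iVY: "integrable M (\<lambda>x. V x * iexp (t * Y x))" for t
    by (rule integrable_const_bound[where B=1]) (use V in \<open>auto simp: norm_mult\<close>)
  have "(\<integral>x. iexp (t * Y x) \<partial>D) = complex_of_real (exp (- (t\<^sup>2) / 2))" for t
  proof -
    have "(\<integral>x. iexp (t * Y x) \<partial>D) = (\<integral>x. ((2 + V x) / (2 + v)) *\<^sub>R iexp (t * Y x) \<partial>M)"
      by (rule Dint) measurable
    also have "\<dots> = (\<integral>x. (2 * iexp (t * Y x) + V x * iexp (t * Y x)) / (2 + v) \<partial>M)"
      by (intro Bochner_Integration.integral_cong) (auto simp: scaleR_conv_of_real field_simps)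
    also have "\<dots> = (2 * complex_of_real (exp (- (t\<^sup>2) / 2)) + v * complex_of_real (exp (- (t\<^sup>2) / 2))) / (2 + v)"
      using iY[of t] iVY[of t] one[of t] ch[of t] by simp
    also have "\<dots> = complex_of_real (2 + v) * complex_of_real (exp (- (t\<^sup>2) / 2)) / (2 + v)" by (simp add: distrib_right)
    also have "\<dots> = complex_of_real (exp (- (t\<^sup>2) / 2))" 
    proof -
      have "complex_of_real (2 + v) \<noteq> 0" using v2 by (simp only: of_real_eq_0_iff)
      then show ?thesis by simp
    qed
    finally show ?thesis .
  qed
  then have "distr D borel Y = std_normal_distribution"
    by (intro D.std_normal_distr_if_char) auto
  moreover have "distr M borel Y = std_normal_distribution"
    by (intro std_normal_distr_if_char one) auto
  ultimately have DM: "(\<integral>x. indicator A (Y x) \<partial>D) = measure std_normal_distribution A"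
     "(\<integral>x. indicator A (Y x) \<partial>M) = measure std_normal_distribution A"
    by (subst integral_distr[symmetric, where N=borel and f="indicator A"]; simp)+
  have iA: "integrable M (\<lambda>x. indicator A (Y x) :: real)" "integrable M (\<lambda>x. V x * indicator A (Y x))"
    by (rule integrable_const_bound[where B=1]; use V in \<open>auto simp: indicator_def\<close>)+
  have "(\<integral>x. (indicator A (Y x) :: real) \<partial>D) = (\<integral>x. ((2 + V x) / (2 + v)) *\<^sub>R indicator A (Y x) \<partial>M)"
    by (rule Dint) measurable
  also have "\<dots> = (\<integral>x. (2 * indicator A (Y x) + V x * indicator A (Y x)) / (2 + v) \<partial>M)"
    by (intro Bochner_Integration.integral_cong) (auto simp: field_simps)
  also have "\<dots> = (2 * measure std_normal_distribution A + (\<integral>x. V x * indicator A (Y x) \<partial>M)) / (2 + v)"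
    using iA by (simp add: DM)
  finally show ?thesis using v2 by (simp add: DM field_simps)
qed

text \<open>The real-weight case is applied to the real and imaginary parts of \<open>W\<close>.
  Their transforms come from those of \<open>W\<close> and its conjugate; conjugation replaces
  \<open>t\<close> by \<open>- t\<close>, which is harmless because the normal characteristic
  function is real and even.\<close>

lemma (in prob_space) weight_indicator_std_normal:
  fixes W :: "'a \<Rightarrow> complex" and Y :: "'a \<Rightarrow> real"
  assumes [measurable]: "W \<in> borel_measurable M" "Y \<in> borel_measurable M" "A \<in> sets borel"
    and W: "\<And>x. norm (W x) \<le> 1"
    and ch: "\<And>t. (\<integral>x. W x * iexp (t * Y x) \<partial>M) = w * complex_of_real (exp (- (t\<^sup>2) / 2))"
    and one: "\<And>t. (\<integral>x. iexp (t * Y x) \<partial>M) = complex_of_real (exp (- (t\<^sup>2) / 2))"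
  shows "(\<integral>x. W x * indicator A (Y x) \<partial>M) = w * measure std_normal_distribution A"
proof -
  have "cnj \<in> borel_measurable borel"
    by (intro borel_measurable_continuous_onI continuous_intros)
  note [measurable] = measurable_compose[OF assms(1) this]
  have iW: "integrable M (\<lambda>x. W x * iexp (t * Y x))" for t
    by (rule integrable_const_bound[where B=1]) (use W in \<open>auto simp: norm_mult\<close>)
  have icW: "integrable M (\<lambda>x. cnj (W x) * iexp (t * Y x))" for t
    by (rule integrable_const_bound[where B=1]) (use W in \<open>auto simp: norm_mult\<close>)
  have ch': "(\<integral>x. cnj (W x) * iexp (t * Y x) \<partial>M) = cnj w * complex_of_real (exp (- (t\<^sup>2) / 2))" for t
  proof -
    have "(\<integral>x. cnj (W x) * iexp (t * Y x) \<partial>M) = (\<integral>x. cnj (W x * iexp (- t * Y x)) \<partial>M)"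
      by (intro Bochner_Integration.integral_cong) (auto simp: exp_cnj)
    also have "\<dots> = cnj (\<integral>x. W x * iexp (- t * Y x) \<partial>M)" by (rule Bochner_Integration.integral_cnj)
    also have "\<dots> = cnj w * complex_of_real (exp (- (t\<^sup>2) / 2))" unfolding ch by (simp add: exp_cnj)
    finally show ?thesis .
  qed
  have Re: "(\<integral>x. Re (W x) * iexp (t * Y x) \<partial>M) = Re w * complex_of_real (exp (- (t\<^sup>2) / 2))" for t
  proof -
    have "(\<integral>x. Re (W x) * iexp (t * Y x) \<partial>M) = (\<integral>x. (W x * iexp (t * Y x) + cnj (W x) * iexp (t * Y x)) / 2 \<partial>M)"
      by (intro Bochner_Integration.integral_cong refl) (simp add: complex_add_cnj flip: distrib_right)
    also have "\<dots> = (w * complex_of_real (exp (- (t\<^sup>2) / 2)) + cnj w * complex_of_real (exp (- (t\<^sup>2) / 2))) / 2"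
      using iW[of t] icW[of t] ch[of t] ch'[of t] by simp
    also have "\<dots> = Re w * complex_of_real (exp (- (t\<^sup>2) / 2))" by (simp add: complex_add_cnj flip: distrib_right)
    finally show ?thesis .
  qed
  have ImW: "complex_of_real (Im z) = (z - cnj z) / (2 * \<i>)" for z
    by (simp add: complex_eq_iff)
  have Im: "(\<integral>x. Im (W x) * iexp (t * Y x) \<partial>M) = Im w * complex_of_real (exp (- (t\<^sup>2) / 2))" for t
  proof -
    have "(\<integral>x. Im (W x) * iexp (t * Y x) \<partial>M) = (\<integral>x. (W x * iexp (t * Y x) - cnj (W x) * iexp (t * Y x)) / (2 * \<i>) \<partial>M)"
      by (intro Bochner_Integration.integral_cong refl) (simp add: ImW left_diff_distrib)
    also have "\<dots> = (w * complex_of_real (exp (- (t\<^sup>2) / 2)) - cnj w * complex_of_real (exp (- (t\<^sup>2) / 2))) / (2 * \<i>)"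
      using iW[of t] icW[of t] ch[of t] ch'[of t] by simp
    also have "\<dots> = Im w * complex_of_real (exp (- (t\<^sup>2) / 2))" by (simp add: ImW left_diff_distrib)
    finally show ?thesis .
  qed
  have b: "\<bar>Re (W x)\<bar> \<le> 1" "\<bar>Im (W x)\<bar> \<le> 1" for x
    using W[of x] abs_Re_le_cmod[of "W x"] abs_Im_le_cmod[of "W x"] by linarith+
  have R: "(\<integral>x. Re (W x) * indicator A (Y x) \<partial>M) = Re w * measure std_normal_distribution A"
    by (rule real_weight_indicator_std_normal) (use b Re one in auto)
  have I: "(\<integral>x. Im (W x) * indicator A (Y x) \<partial>M) = Im w * measure std_normal_distribution A"
    by (rule real_weight_indicator_std_normal) (use b Im one in auto)
  have iWA: "integrable M (\<lambda>x. W x * indicator A (Y x))"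
    by (rule integrable_const_bound[where B=1]) (use W in \<open>auto simp: indicator_def\<close>)
  have "Re (W x * indicator A (Y x)) = Re (W x) * indicator A (Y x)" 
     "Im (W x * indicator A (Y x)) = Im (W x) * indicator A (Y x)" for x
    by (auto simp: indicator_def)
  then show ?thesis
    using R I iWA by (intro complex_eqI) (simp_all flip: integral_Re integral_Im)
qed

text \<open>
  The exponential factors are replaced one coordinate at a time by indicators, which needs only
  the one-dimensional uniqueness theorem.
\<close>

lemma (in prob_space) PiM_std_normal_distr_if_char:
  fixes \<psi> :: "nat \<Rightarrow> 'a \<Rightarrow> real"
  assumes [measurable]: "\<And>i. \<psi> i \<in> borel_measurable M"
    and ch: "\<And>t. (\<integral>x. iexp (\<Sum>l<k. t l * \<psi> l x) \<partial>M) = complex_of_real (exp (- (\<Sum>l<k. (t l)\<^sup>2) / 2))"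
  shows "distr M (PiM {..<k} (\<lambda>_. std_normal_distribution)) (\<lambda>x. \<lambda>i\<in>{..<k}. \<psi> i x)
    = PiM {..<k} (\<lambda>_. std_normal_distribution)"
proof -
  interpret S: prob_space std_normal_distribution by (rule prob_space_normal_density) simp
  interpret product_sigma_finite "\<lambda>_::nat. std_normal_distribution" ..
  have meas: "(\<lambda>x. \<lambda>i\<in>{..<k}. \<psi> i x) \<in> measurable M (PiM {..<k} (\<lambda>_. std_normal_distribution))"
    by (rule measurable_restrict) simp
  show ?thesis
  proof (rule PiM_eqI)
    fix A :: "nat \<Rightarrow> real set" assume "\<And>i. i \<in> {..<k} \<Longrightarrow> A i \<in> sets std_normal_distribution"
    then have A[measurable]: "i < k \<Longrightarrow> A i \<in> sets borel" for i by simp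
    have claim: "(\<integral>x. (\<Prod>i<j. indicator (A i) (\<psi> i x)) * iexp (\<Sum>l\<in>{j..<k}. t l * \<psi> l x) \<partial>M)
       = complex_of_real ((\<Prod>i<j. measure std_normal_distribution (A i)) * exp (- (\<Sum>l\<in>{j..<k}. (t l)\<^sup>2) / 2))"
      if "j \<le> k" for j t
      using that
    proof (induction j arbitrary: t)
      case 0
      then show ?case using ch[of t] by (simp add: atLeast0LessThan)
    next
      case (Suc j)
      then have jk: "j < k" by simp
      then have split: "{j..<k} = insert j {Suc j..<k}" by auto
      have [measurable]: "(\<lambda>x. \<Prod>i<j. indicator (A i) (\<psi> i x) :: complex) \<in> borel_measurable M"
      proof (rule borel_measurable_prod)
        fix i assume "i \<in> {..<j}"
        then have [measurable]: "A i \<in> sets borel" using jk by (intro A) simp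
        show "(\<lambda>x. indicator (A i) (\<psi> i x) :: complex) \<in> borel_measurable M" by measurable
      qed
      have [measurable]: "A j \<in> sets borel" using jk by measurable
      define W where "W x = (\<Prod>i<j. indicator (A i) (\<psi> i x)) * iexp (\<Sum>l\<in>{Suc j..<k}. t l * \<psi> l x)" for x
      define w where "w = (\<Prod>i<j. measure std_normal_distribution (A i)) * exp (- (\<Sum>l\<in>{Suc j..<k}. (t l)\<^sup>2) / 2)"
      have "(\<integral>x. W x * indicator (A j) (\<psi> j x) \<partial>M) = complex_of_real w * measure std_normal_distribution (A j)"
      proof (rule weight_indicator_std_normal)
        show "W \<in> borel_measurable M" unfolding W_def by measurable
        show "norm (W x) \<le> 1" for x
        proof -
          have "norm (\<Prod>i<j. indicator (A i) (\<psi> i x) :: complex) \<le> 1"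
            unfolding prod_norm[symmetric] by (intro prod_le_1) (auto simp: indicator_def)
          then show ?thesis unfolding W_def by (simp add: norm_mult del: of_real_sum)
        qed
        fix s
        \<comment> \<open>The induction hypothesis holds for every frequency vector; letting its
          entry at \<open>j\<close> vary as \<open>s\<close> gives the transform of
          \<open>\<psi> j\<close> under the weight \<open>W\<close>, which contains all the other
          factors.\<close>
        have *: "(\<Sum>l\<in>{j..<k}. (t(j := s)) l * \<psi> l x) = s * \<psi> j x + (\<Sum>l\<in>{Suc j..<k}. t l * \<psi> l x)" for x
          unfolding split by (subst sum.insert) (auto intro!: sum.cong)
        have **: "(\<Sum>l\<in>{j..<k}. ((t(j := s)) l)\<^sup>2) = s\<^sup>2 + (\<Sum>l\<in>{Suc j..<k}. (t l)\<^sup>2)"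
          unfolding split by (subst sum.insert) (auto intro!: sum.cong)
        have "(\<integral>x. W x * iexp (s * \<psi> j x) \<partial>M) = (\<integral>x. (\<Prod>i<j. indicator (A i) (\<psi> i x)) * iexp (\<Sum>l\<in>{j..<k}. (t(j := s)) l * \<psi> l x) \<partial>M)"
          unfolding * W_def by (simp add: exp_add distrib_left mult_ac)
        also have "\<dots> = complex_of_real ((\<Prod>i<j. measure std_normal_distribution (A i)) * exp (- (s\<^sup>2 + (\<Sum>l\<in>{Suc j..<k}. (t l)\<^sup>2)) / 2))"
          by (subst Suc.IH) (use jk in \<open>simp_all only: ** less_imp_le\<close>)
        also have "\<dots> = complex_of_real w * complex_of_real (exp (- s\<^sup>2 / 2))"
        proof -
          have e: "exp (- (a + b) / 2) = exp (- b / 2) * exp (- a / 2)" for a b :: real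
            by (subst exp_add[symmetric]) (simp add: field_simps)
          show ?thesis unfolding w_def e of_real_mult by (simp only: mult_ac)
        qed
        finally show "(\<integral>x. W x * iexp (s * \<psi> j x) \<partial>M) = complex_of_real w * complex_of_real (exp (- s\<^sup>2 / 2))" .
        \<comment> \<open>A frequency vector supported at \<open>j\<close> shows that
          \<open>\<psi> j\<close> alone has the standard normal characteristic function.\<close>
        have "(\<Sum>l<k. (if l = j then s else 0) * \<psi> l x) = s * \<psi> j x" for x
          using jk by (simp add: if_distrib[of "\<lambda>c. c * _"] cong: if_cong)
        moreover have "(\<Sum>l<k. (if l = j then s else 0)\<^sup>2) = s\<^sup>2"
          using jk by (simp add: if_distrib[of "\<lambda>c. c ^ 2"] cong: if_cong)
        ultimately show "(\<integral>x. iexp (s * \<psi> j x) \<partial>M) = complex_of_real (exp (- s\<^sup>2 / 2))"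
          using ch[of "\<lambda>l. if l = j then s else 0"] by simp
      qed measurable
      then show ?case by (simp add: W_def w_def mult_ac lessThan_Suc)
    qed
    have "complex_of_real (\<integral>x. (\<Prod>i<k. indicator (A i) (\<psi> i x)) \<partial>M) = (\<integral>x. (\<Prod>i<k. indicator (A i) (\<psi> i x)) \<partial>M)"
      by (simp add: of_real_indicator flip: integral_complex_of_real)
    also have "\<dots> = complex_of_real (\<Prod>i<k. measure std_normal_distribution (A i))"
      using claim[of k] by simp
    finally have r: "(\<integral>x. (\<Prod>i<k. indicator (A i) (\<psi> i x)) \<partial>M) = (\<Prod>i<k. measure std_normal_distribution (A i))"
      by (simp only: of_real_eq_iff)
    define E where "E = (\<lambda>x. \<lambda>i\<in>{..<k}. \<psi> i x) -` (PiE {..<k} A) \<inter> space M"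
    have E: "E \<in> sets M"
      unfolding E_def by (rule measurable_sets[OF meas]) (intro sets_PiM_I_finite, auto)
    have "(\<Prod>i<k. indicator (A i) (\<psi> i x)) = (indicator E x :: real)" if "x \<in> space M" for x
      using that by (auto simp: E_def indicator_def PiE_iff)
    then have "(\<integral>x. (\<Prod>i<k. indicator (A i) (\<psi> i x)) \<partial>M) = measure M E"
      using E by (subst Bochner_Integration.integral_cong[OF refl, where g="indicator E"]) auto
    then have "measure M E = (\<Prod>i<k. measure std_normal_distribution (A i))" using r by simp
    then have "emeasure M E = (\<Prod>i<k. emeasure std_normal_distribution (A i))"
      by (simp add: emeasure_eq_measure S.emeasure_eq_measure prod_ennreal)
    moreover have "emeasure (distr M (PiM {..<k} (\<lambda>_. std_normal_distribution)) (\<lambda>x. \<lambda>i\<in>{..<k}. \<psi> i x)) (PiE {..<k} A) = emeasure M E"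
      unfolding E_def by (rule emeasure_distr[OF meas]) (intro sets_PiM_I_finite, auto)
    ultimately show "emeasure (distr M (PiM {..<k} (\<lambda>_. std_normal_distribution)) (\<lambda>x. \<lambda>i\<in>{..<k}. \<psi> i x)) (PiE {..<k} A)
      = (\<Prod>i<k. emeasure std_normal_distribution (A i))" by simp
  qed auto
qed

section \<open>Variance and characteristic function of a functional\<close>

lemma centered_gaussian_measurable_functional:
  fixes M :: "'a::real_normed_vector measure"
  assumes "centered_gaussian M" "bounded_linear \<phi>"
  shows "\<phi> \<in> borel_measurable M"
proof -
  have "sets M = sets borel" using assms by (simp add: centered_gaussian_def)
  moreover have "\<phi> \<in> borel_measurable borel"
    using assms(2) by (intro borel_measurable_continuous_onI linear_continuous_on)
  ultimately show ?thesis by (simp cong: measurable_cong_sets)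
qed

lemma normal_density_eq_distr_std_normal:
  assumes "\<sigma> > 0"
  shows "density lborel (\<lambda>x. ennreal (normal_density 0 \<sigma> x)) = distr std_normal_distribution borel (\<lambda>x. \<sigma> * x)"
proof -
  interpret S: prob_space std_normal_distribution by (rule prob_space_normal_density) simp
  have "distributed std_normal_distribution lborel (\<lambda>x. x) std_normal_density"
    by (simp add: distributed_def distr_id2)
  from S.normal_density_affine[OF this, of \<sigma> 0] assms
  have "distributed std_normal_distribution lborel (\<lambda>x. \<sigma> * x) (normal_density 0 \<sigma>)" by simp
  then show ?thesis by (simp add: distributed_def cong: distr_cong)
qed

text \<open>This condenses Gaussianity into what the sequel uses: the variance is finite and
  determines the characteristic function. The formula also covers the degenerate marginal, which has
  variance 0.\<close>

lemma centered_gaussian_functional: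
  fixes M :: "'a::real_normed_vector measure"
  assumes M: "centered_gaussian M" and \<phi>: "bounded_linear \<phi>"
  shows "integrable M (\<lambda>x. (\<phi> x)\<^sup>2)"
    and "(\<integral>x. iexp (\<phi> x) \<partial>M) = complex_of_real (exp (- (\<integral>x. (\<phi> x)\<^sup>2 \<partial>M) / 2))"
proof -
  interpret prob_space M using M by (simp add: centered_gaussian_def)
  note [measurable] = centered_gaussian_measurable_functional[OF M \<phi>]
  have "integrable M (\<lambda>x. (\<phi> x)\<^sup>2) \<and> (\<integral>x. iexp (\<phi> x) \<partial>M) = complex_of_real (exp (- (\<integral>x. (\<phi> x)\<^sup>2 \<partial>M) / 2))"
  proof (cases "distr M borel \<phi> = return borel 0")
    case True
    have "integrable (distr M borel \<phi>) (\<lambda>x. x\<^sup>2)" unfolding True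
      by (simp add: integrable_iff_bounded nn_integral_return)
    then have 1: "integrable M (\<lambda>x. (\<phi> x)\<^sup>2)" by (subst (asm) integrable_distr_eq) auto
    have 2: "(\<integral>x. (\<phi> x)\<^sup>2 \<partial>M) = 0"
      using integral_distr[of \<phi> M borel "\<lambda>x. x\<^sup>2"] by (simp add: True integral_return)
    have "(\<integral>x. iexp (\<phi> x) \<partial>M) = 1"
      using integral_distr[of \<phi> M borel iexp] by (simp add: True integral_return)
    then show ?thesis using 1 2 by simp
  next
    case False
    then obtain \<sigma> where \<sigma>: "\<sigma> > 0" "distr M borel \<phi> = distr std_normal_distribution borel (\<lambda>x. \<sigma> * x)"
      using M \<phi> unfolding centered_gaussian_def by (metis normal_density_eq_distr_std_normal)
    have i2: "integrable std_normal_distribution (\<lambda>x. (\<sigma> * x)\<^sup>2)" "(\<integral>x. (\<sigma> * x)\<^sup>2 \<partial>std_normal_distribution) = \<sigma>\<^sup>2"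
      using integrable_std_normal_moment[of 2] integral_std_normal_moment_even[of 1]
      by (simp_all add: power_mult_distrib integrable_density integral_density fact_numeral)
    have 1: "integrable M (\<lambda>x. (\<phi> x)\<^sup>2)"
    proof -
      have "integrable (distr M borel \<phi>) (\<lambda>x. x\<^sup>2)" unfolding \<sigma>
        using i2 by (subst integrable_distr_eq) auto
      then show ?thesis by (subst (asm) integrable_distr_eq) auto
    qed
    have 2: "(\<integral>x. (\<phi> x)\<^sup>2 \<partial>M) = \<sigma>\<^sup>2"
      using integral_distr[of \<phi> M borel "\<lambda>x. x\<^sup>2"] i2 by (simp add: \<sigma> integral_distr)
    have "(\<integral>x. iexp (\<phi> x) \<partial>M) = (\<integral>x. iexp (\<sigma> * x) \<partial>std_normal_distribution)"
      using integral_distr[of \<phi> M borel iexp] by (simp add: \<sigma> integral_distr)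
    also have "\<dots> = complex_of_real (exp (- \<sigma>\<^sup>2 / 2))"
      using char_std_normal_distribution by (simp add: char_def fun_eq_iff)
    finally show ?thesis using 1 2 by simp
  qed
  then show "integrable M (\<lambda>x. (\<phi> x)\<^sup>2)"
    "(\<integral>x. iexp (\<phi> x) \<partial>M) = complex_of_real (exp (- (\<integral>x. (\<phi> x)\<^sup>2 \<partial>M) / 2))" by auto
qed

subsection \<open>Cylinder sets\<close>

lemma centered_gaussian_integrable_mult:
  fixes M :: "'a::real_normed_vector measure" and \<phi> \<psi> :: "'a \<Rightarrow> real"
  assumes M: "centered_gaussian M" and \<phi>: "bounded_linear \<phi>" and \<psi>: "bounded_linear \<psi>"
  shows "integrable M (\<lambda>x. \<phi> x * \<psi> x)"
proof (rule Bochner_Integration.integrable_bound)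
  note [measurable] = centered_gaussian_measurable_functional[OF M \<phi>] centered_gaussian_measurable_functional[OF M \<psi>]
  show "integrable M (\<lambda>x. (\<phi> x)\<^sup>2 + (\<psi> x)\<^sup>2)"
    by (intro Bochner_Integration.integrable_add centered_gaussian_functional(1) M \<phi> \<psi>)
  show "(\<lambda>x. \<phi> x * \<psi> x) \<in> borel_measurable M" by measurable
  have "\<bar>a * b\<bar> \<le> a\<^sup>2 + b\<^sup>2" for a b :: real
  proof -
    have "2 * (\<bar>a\<bar> * \<bar>b\<bar>) \<le> \<bar>a\<bar>\<^sup>2 + \<bar>b\<bar>\<^sup>2" using sum_squares_bound[of "\<bar>a\<bar>" "\<bar>b\<bar>"] by (simp add: mult_ac)
    moreover have "0 \<le> \<bar>a\<bar> * \<bar>b\<bar>" by simp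
    ultimately have "\<bar>a\<bar> * \<bar>b\<bar> \<le> \<bar>a\<bar>\<^sup>2 + \<bar>b\<bar>\<^sup>2" by linarith
    then show ?thesis by (simp add: abs_mult)
  qed
  then show "AE x in M. norm (\<phi> x * \<psi> x) \<le> norm ((\<phi> x)\<^sup>2 + (\<psi> x)\<^sup>2)" by auto
qed

lemma bounded_linear_lincomb:
  fixes \<psi> :: "nat \<Rightarrow> 'a::real_normed_vector \<Rightarrow> real"
  assumes "\<And>l. l < k \<Longrightarrow> bounded_linear (\<psi> l)"
  shows "bounded_linear (\<lambda>x. \<Sum>l<k. t l * (\<psi> l x :: real))"
  using assms by (intro bounded_linear_sum bounded_linear_const_mult) auto

lemma centered_gaussian_cov_lincomb:
  fixes M :: "'a::real_normed_vector measure" and \<psi> :: "nat \<Rightarrow> 'a \<Rightarrow> real"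
  assumes M: "centered_gaussian M" and \<psi>: "\<And>l. l < k \<Longrightarrow> bounded_linear (\<psi> l)" and \<phi>: "bounded_linear \<phi>"
  shows "(\<integral>x. (\<Sum>l<k. t l * \<psi> l x) * \<phi> x \<partial>M) = (\<Sum>l<k. t l * (\<integral>x. \<psi> l x * \<phi> x \<partial>M))"
proof -
  have "(\<integral>x. (\<Sum>l<k. t l * \<psi> l x) * \<phi> x \<partial>M) = (\<integral>x. (\<Sum>l<k. t l * (\<psi> l x * \<phi> x)) \<partial>M)"
    by (simp add: sum_distrib_right mult.assoc)
  also have "\<dots> = (\<Sum>l<k. (\<integral>x. t l * (\<psi> l x * \<phi> x) \<partial>M))"
    using centered_gaussian_integrable_mult[OF M \<psi> \<phi>]
    by (intro Bochner_Integration.integral_sum) auto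
  finally show ?thesis by simp
qed

text \<open>Gram-Schmidt for the covariance form, one functional at a time. The residual
  \<open>\<eta>\<close> of \<open>\<phi> n\<close> after projection is either null, in which case
  \<open>k\<close> stays and the expansion of \<open>\<phi> n\<close> holds almost everywhere, or it
  is normalized and becomes the next \<open>\<psi>\<close>.\<close>

lemma centered_gaussian_orthonormal_basis:
  fixes M :: "'a::real_normed_vector measure" and \<phi> :: "nat \<Rightarrow> 'a \<Rightarrow> real"
  assumes M: "centered_gaussian M" and \<phi>: "\<And>i. bounded_linear (\<phi> i)"
  shows "\<exists>(k::nat) \<psi> a. (\<forall>j. bounded_linear (\<psi> j)) \<and>
    (\<forall>i<k. \<forall>j<k. (\<integral>x. \<psi> i x * \<psi> j x \<partial>M) = (if i = j then 1 else 0)) \<and>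
    (\<forall>i<n. AE x in M. \<phi> i x = (\<Sum>j<k. a i j * \<psi> j x))"
proof (induction n)
  case 0
  show ?case by (rule exI[of _ "0::nat"], rule exI[of _ "(\<lambda>_ _. 0) :: nat \<Rightarrow> 'a \<Rightarrow> real"]) auto
next
  case (Suc n)
  then obtain k :: nat and \<psi> a where frame: "\<forall>j. bounded_linear (\<psi> j)"
    "\<forall>i<k. \<forall>j<k. (\<integral>x. \<psi> i x * \<psi> j x \<partial>M) = (if i = j then 1 else 0)"
    "\<forall>i<n. AE x in M. \<phi> i x = (\<Sum>j<k. a i j * \<psi> j x)"
    by (elim exE conjE) (rule that; assumption)
  have \<psi>: "bounded_linear (\<psi> j)" for j
    using frame(1) by simp
  have on: "(\<integral>x. \<psi> i x * \<psi> j x \<partial>M) = (if i = j then 1 else 0)" if "i < k" "j < k" for i j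
    using frame(2) that by simp
  have a: "AE x in M. \<phi> i x = (\<Sum>j<k. a i j * \<psi> j x)" if "i < n" for i
    using frame(3) that by simp
  define c where "c j = (\<integral>x. \<phi> n x * \<psi> j x \<partial>M)" for j
  define \<eta> where "\<eta> x = \<phi> n x - (\<Sum>j<k. c j * \<psi> j x)" for x
  have \<eta>: "bounded_linear \<eta>" unfolding \<eta>_def
    by (intro bounded_linear_sub \<phi> bounded_linear_lincomb \<psi>)
  note [measurable] = centered_gaussian_measurable_functional[OF M \<eta>]
  have orth: "(\<integral>x. \<eta> x * \<psi> i x \<partial>M) = 0" if "i < k" for i
  proof -
    have "(\<integral>x. \<eta> x * \<psi> i x \<partial>M) = c i - (\<integral>x. (\<Sum>j<k. c j * \<psi> j x) * \<psi> i x \<partial>M)"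
      unfolding \<eta>_def left_diff_distrib c_def
      by (intro Bochner_Integration.integral_diff centered_gaussian_integrable_mult M \<phi> \<psi> bounded_linear_lincomb)
    also have "(\<integral>x. (\<Sum>j<k. c j * \<psi> j x) * \<psi> i x \<partial>M) = (\<Sum>j<k. if j = i then c j else 0)"
      unfolding centered_gaussian_cov_lincomb[OF M \<psi> \<psi>] using that by (intro sum.cong) (auto simp: on)
    finally show ?thesis using that by simp
  qed
  define q where "q = (\<integral>x. (\<eta> x)\<^sup>2 \<partial>M)"
  have "0 \<le> q" by (simp add: q_def)
  show ?case
  proof (cases "q = 0")
    case True
    then have "AE x in M. (\<eta> x)\<^sup>2 = 0"
      using integral_nonneg_eq_0_iff_AE[of M "\<lambda>x. (\<eta> x)\<^sup>2"] centered_gaussian_functional(1)[OF M \<eta>] by (simp add: q_def)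
    then have "AE x in M. \<phi> n x = (\<Sum>j<k. c j * \<psi> j x)" by (simp add: \<eta>_def)
    then have "\<forall>i<Suc n. AE x in M. \<phi> i x = (\<Sum>j<k. (a(n := c)) i j * \<psi> j x)"
      using a by (auto simp: less_Suc_eq)
    with \<psi> on show ?thesis by blast
  next
    case False
    with \<open>0 \<le> q\<close> have "0 < q" by simp
    define \<sigma> where "\<sigma> = sqrt q"
    have \<sigma>: "0 < \<sigma>" "\<sigma> * \<sigma> = q" using \<open>0 < q\<close> by (auto simp: \<sigma>_def)
    define \<psi>' where "\<psi>' = \<psi>(k := (\<lambda>x. \<eta> x / \<sigma>))"
    have "bounded_linear (\<lambda>x. \<eta> x / \<sigma>)"
      using bounded_linear_const_mult[OF \<eta>, of "1 / \<sigma>"] by simp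
    then have \<psi>': "\<forall>j. bounded_linear (\<psi>' j)" using \<psi> by (auto simp: \<psi>'_def)
    have on': "(\<integral>x. \<psi>' i x * \<psi>' j x \<partial>M) = (if i = j then 1 else 0)" if ij: "i < Suc k" "j < Suc k" for i j
    proof -
      consider "i < k" "j < k" | "i = k" "j < k" | "i < k" "j = k" | "i = k" "j = k"
        using ij by linarith
      then show ?thesis
      proof cases
        case 1 then show ?thesis using on by (simp add: \<psi>'_def)
      next
        case 2 then show ?thesis using orth[of j] by (simp add: \<psi>'_def)
      next
        case 3 then show ?thesis using orth[of i] by (simp add: \<psi>'_def mult.commute)
      next
        case 4 then show ?thesis using \<sigma> \<open>0 < q\<close> by (simp add: \<psi>'_def q_def power2_eq_square)
      qed
    qed
    \<comment> \<open>Earlier rows get coefficient 0 at the new functional; the new row consists of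
      the projection coefficients followed by the norm \<sigma> of the residual.\<close>
    define a' where "a' i j = (if i < n then (if j < k then a i j else 0) else if j < k then c j else \<sigma>)" for i j
    have "AE x in M. \<phi> i x = (\<Sum>j<Suc k. a' i j * \<psi>' j x)" if "i < Suc n" for i
    proof (cases "i < n")
      case True
      then show ?thesis using a[OF True] by (simp add: a'_def \<psi>'_def)
    next
      case False
      then have "i = n" using that by simp
      have "\<phi> n x = (\<Sum>j<k. c j * \<psi> j x) + \<eta> x" for x by (simp add: \<eta>_def)
      then show ?thesis unfolding \<open>i = n\<close> using \<sigma> by (simp add: a'_def \<psi>'_def)
    qed
    with \<psi>' on' show ?thesis by blast
  qed
qed

text \<open>Orthonormality gives a linear combination with coefficients \<open>t\<close> the
  variance \<open>\<Sum>l<k. (t l)\<^sup>2\<close>. As the combination is again a bounded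
  functional, its characteristic function is known, and this is the joint characteristic function of
  independent standard normals.\<close>

lemma centered_gaussian_orthonormal_distr:
  fixes M :: "'a::real_normed_vector measure" and \<psi> :: "nat \<Rightarrow> 'a \<Rightarrow> real"
  assumes M: "centered_gaussian M" and \<psi>: "\<And>j. bounded_linear (\<psi> j)"
    and on: "\<And>i j. i < k \<Longrightarrow> j < k \<Longrightarrow> (\<integral>x. \<psi> i x * \<psi> j x \<partial>M) = (if i = j then 1 else 0)"
  shows "distr M (PiM {..<k} (\<lambda>_. std_normal_distribution)) (\<lambda>x. \<lambda>i\<in>{..<k}. \<psi> i x)
    = PiM {..<k} (\<lambda>_. std_normal_distribution)"
proof -
  interpret prob_space M using M by (simp add: centered_gaussian_def)
  show ?thesis
  proof (rule PiM_std_normal_distr_if_char)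
    show "\<psi> i \<in> borel_measurable M" for i by (intro centered_gaussian_measurable_functional M \<psi>)
    fix t :: "nat \<Rightarrow> real"
    define \<theta> where "\<theta> x = (\<Sum>l<k. t l * \<psi> l x)" for x
    have \<theta>: "bounded_linear \<theta>" unfolding \<theta>_def by (intro bounded_linear_lincomb \<psi>)
    have "(\<integral>x. (\<theta> x)\<^sup>2 \<partial>M) = (\<Sum>l<k. t l * (\<integral>x. \<psi> l x * \<theta> x \<partial>M))"
      unfolding power2_eq_square by (subst (1) \<theta>_def) (intro centered_gaussian_cov_lincomb M \<psi> \<theta>)
    also have "\<dots> = (\<Sum>l<k. (t l)\<^sup>2)"
    proof (rule sum.cong)
      fix l assume l: "l \<in> {..<k}"
      have "(\<integral>x. \<psi> l x * \<theta> x \<partial>M) = (\<integral>x. \<theta> x * \<psi> l x \<partial>M)" by (simp add: mult.commute)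
      also have "\<dots> = (\<Sum>i<k. t i * (\<integral>x. \<psi> i x * \<psi> l x \<partial>M))"
        unfolding \<theta>_def by (intro centered_gaussian_cov_lincomb M \<psi>)
      also have "\<dots> = (\<Sum>i<k. if i = l then t i else 0)"
        using l by (intro sum.cong) (auto simp: on)
      also have "\<dots> = t l" using l by simp
      finally show "t l * (\<integral>x. \<psi> l x * \<theta> x \<partial>M) = (t l)\<^sup>2" by (simp add: power2_eq_square)
    qed simp
    finally show "(\<integral>x. iexp (\<Sum>l<k. t l * \<psi> l x) \<partial>M) = complex_of_real (exp (- (\<Sum>l<k. (t l)\<^sup>2) / 2))"
      using centered_gaussian_functional(2)[OF M \<theta>] by (simp add: \<theta>_def)
  qed
qed

text \<open>Orthonormal coordinates carry a cylinder, up to a null set, to the convex set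
  \<open>U\<close> under the product measure \<open>P\<close>. Log-concavity is then
  Prekopa-Leindler for indicators, as midpoints of points of two such sets lie in the averaged set
  \<open>H\<close>.\<close>

lemma centered_gaussian_cylinder:
  fixes M :: "'a::real_normed_vector measure" and \<phi> :: "nat \<Rightarrow> 'a \<Rightarrow> real"
  assumes M: "centered_gaussian M" and \<phi>: "\<And>i. bounded_linear (\<phi> i)"
  shows centered_gaussian_cylinder_log_concave:
      "measure M {x \<in> space M. \<forall>i<n. \<bar>\<phi> i x - \<zeta> i\<bar> \<le> s} * measure M {x \<in> space M. \<forall>i<n. \<bar>\<phi> i x - \<xi> i\<bar> \<le> t}
       \<le> (measure M {x \<in> space M. \<forall>i<n. \<bar>\<phi> i x - (\<zeta> i + \<xi> i) / 2\<bar> \<le> (s + t) / 2})\<^sup>2"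
    and centered_gaussian_cylinder_symmetric:
      "measure M {x \<in> space M. \<forall>i<n. \<bar>\<phi> i x + \<zeta> i\<bar> \<le> s} = measure M {x \<in> space M. \<forall>i<n. \<bar>\<phi> i x - \<zeta> i\<bar> \<le> s}"
proof -
  interpret prob_space M using M by (simp add: centered_gaussian_def)
  obtain k :: nat and \<psi> a where frame: "\<forall>j. bounded_linear (\<psi> j)"
    "\<forall>i<k. \<forall>j<k. (\<integral>x. \<psi> i x * \<psi> j x \<partial>M) = (if i = j then 1 else 0)"
    "\<forall>i<n. AE x in M. \<phi> i x = (\<Sum>j<k. a i j * \<psi> j x)"
    using centered_gaussian_orthonormal_basis[OF M, of \<phi> n, OF \<phi>]
    by (elim exE conjE) (rule that; assumption)
  have \<psi>: "bounded_linear (\<psi> j)" for j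
    using frame(1) by simp
  have on: "(\<integral>x. \<psi> i x * \<psi> j x \<partial>M) = (if i = j then 1 else 0)" if "i < k" "j < k" for i j
    using frame(2) that by simp
  have a: "AE x in M. \<phi> i x = (\<Sum>j<k. a i j * \<psi> j x)" if "i < n" for i
    using frame(3) that by simp
  define P where "P = PiM {..<k} (\<lambda>_::nat. std_normal_distribution)"
  define U where "U \<zeta> s = {y \<in> space P. \<forall>i<n. \<bar>(\<Sum>j<k. a i j * y j) - \<zeta> i\<bar> \<le> s}" for \<zeta> s
  have comp: "(\<lambda>y. y j) \<in> borel_measurable P" if "j < k" for j
    using measurable_component_singleton[of j "{..<k}" "\<lambda>_. std_normal_distribution"] that by (simp add: P_def)
  have lin[measurable]: "(\<lambda>y. \<Sum>j<k. a i j * y j) \<in> borel_measurable P" for i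
    by (intro borel_measurable_sum borel_measurable_times comp) auto
  have U[measurable]: "U \<zeta> s \<in> sets P" for \<zeta> s
    unfolding U_def by measurable
  note [measurable] = centered_gaussian_measurable_functional[OF M \<phi>]
  \<comment> \<open>The sign \<epsilon> is 1 or -1. Changing the sign of all \<open>\<psi>\<close>
    preserves orthonormality and hence the image measure \<open>P\<close>; comparing the two signs
    yields the symmetry claim.\<close>
  have transfer: "emeasure M {x \<in> space M. \<forall>i<n. \<bar>\<epsilon> * \<phi> i x - \<zeta> i\<bar> \<le> s} = emeasure P (U \<zeta> s)"
    if \<epsilon>: "\<epsilon> * \<epsilon> = 1" for \<zeta> s and \<epsilon> :: real
  proof -
    define T where "T x = (\<lambda>i\<in>{..<k}. \<epsilon> * \<psi> i x)" for x
    have \<epsilon>\<psi>: "bounded_linear (\<lambda>x. \<epsilon> * \<psi> j x)" for j by (intro bounded_linear_const_mult \<psi>)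
    have T[measurable]: "T \<in> measurable M P"
      unfolding T_def P_def using centered_gaussian_measurable_functional[OF M \<epsilon>\<psi>]
      by (intro measurable_restrict) simp
    have "distr M P T = P"
      unfolding T_def P_def
    proof (intro centered_gaussian_orthonormal_distr M \<epsilon>\<psi>)
      fix i j assume ij: "i < k" "j < k"
      have "\<epsilon> * \<psi> i x * (\<epsilon> * \<psi> j x) = (\<epsilon> * \<epsilon>) * (\<psi> i x * \<psi> j x)" for x by (simp only: mult_ac)
      then have e: "\<epsilon> * \<psi> i x * (\<epsilon> * \<psi> j x) = \<psi> i x * \<psi> j x" for x by (simp only: \<epsilon> mult_1)
      show "(\<integral>x. \<epsilon> * \<psi> i x * (\<epsilon> * \<psi> j x) \<partial>M) = (if i = j then 1 else 0)"
        unfolding e by (rule on[OF ij])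
    qed
    then have "emeasure P (U \<zeta> s) = emeasure M (T -` U \<zeta> s \<inter> space M)"
      using emeasure_distr[OF T U] by simp
    also have "\<dots> = emeasure M {x \<in> space M. \<forall>i<n. \<bar>\<epsilon> * \<phi> i x - \<zeta> i\<bar> \<le> s}"
    proof (rule emeasure_eq_AE)
      have "AE x in M. \<forall>i\<in>{..<n}. \<phi> i x = (\<Sum>j<k. a i j * \<psi> j x)"
        using a by (intro AE_finite_allI) auto
      then show "AE x in M. x \<in> T -` U \<zeta> s \<inter> space M \<longleftrightarrow> x \<in> {x \<in> space M. \<forall>i<n. \<bar>\<epsilon> * \<phi> i x - \<zeta> i\<bar> \<le> s}"
      proof (rule AE_mp[OF _ AE_I2], intro impI)
        fix x assume x: "x \<in> space M" and eq: "\<forall>i\<in>{..<n}. \<phi> i x = (\<Sum>j<k. a i j * \<psi> j x)"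
        have "(\<Sum>j<k. a i j * T x j) = \<epsilon> * \<phi> i x" if "i < n" for i
          using eq that by (simp add: T_def sum_distrib_left mult_ac)
        then show "x \<in> T -` U \<zeta> s \<inter> space M \<longleftrightarrow> x \<in> {x \<in> space M. \<forall>i<n. \<bar>\<epsilon> * \<phi> i x - \<zeta> i\<bar> \<le> s}"
          using x measurable_space[OF T x] by (auto simp: U_def)
      qed
    qed measurable
    finally show ?thesis ..
  qed
  have transfer_pos: "emeasure M {x \<in> space M. \<forall>i<n. \<bar>\<phi> i x - \<zeta> i\<bar> \<le> s} = emeasure P (U \<zeta> s)" for \<zeta> s
    using transfer[of 1] by simp
  show "measure M {x \<in> space M. \<forall>i<n. \<bar>\<phi> i x + \<zeta> i\<bar> \<le> s} = measure M {x \<in> space M. \<forall>i<n. \<bar>\<phi> i x - \<zeta> i\<bar> \<le> s}"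
  proof -
    have "\<bar>- \<phi> i x - \<zeta> i\<bar> = \<bar>\<phi> i x + \<zeta> i\<bar>" for i x by (simp add: abs_if)
    then show ?thesis using transfer[of "-1" \<zeta> s] transfer_pos[of \<zeta> s] by (simp add: measure_def)
  qed
  define H where "H = U (\<lambda>i. (\<zeta> i + \<xi> i) / 2) ((s + t) / 2)"
  have "(\<integral>\<^sup>+y. indicator (U \<zeta> s) y \<partial>P) * (\<integral>\<^sup>+y. indicator (U \<xi> t) y \<partial>P) \<le> (\<integral>\<^sup>+y. indicator H y \<partial>P)\<^sup>2"
    unfolding P_def
  proof (rule prekopa_leindler_PiM_std_normal, fold P_def)
    fix x y assume xy: "x \<in> space P" "y \<in> space P"
    define z where "z = (\<lambda>i\<in>{..<k}. (x i + y i) / 2)"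
    have z: "z \<in> space P" by (simp add: z_def P_def space_PiM)
    have "z \<in> H" if "x \<in> U \<zeta> s" "y \<in> U \<xi> t"
    proof -
      have "\<bar>(\<Sum>j<k. a i j * z j) - (\<zeta> i + \<xi> i) / 2\<bar> \<le> (s + t) / 2" if i: "i < n" for i
      proof -
        have "(\<Sum>j<k. a i j * z j) = (\<Sum>j<k. (a i j * x j + a i j * y j) / 2)"
          by (intro sum.cong) (auto simp: z_def field_simps)
        also have "\<dots> = ((\<Sum>j<k. a i j * x j) + (\<Sum>j<k. a i j * y j)) / 2"
          by (simp add: sum.distrib flip: sum_divide_distrib)
        finally have e: "(\<Sum>j<k. a i j * z j) = ((\<Sum>j<k. a i j * x j) + (\<Sum>j<k. a i j * y j)) / 2" .
        have "\<bar>(\<Sum>j<k. a i j * x j) - \<zeta> i\<bar> \<le> s" "\<bar>(\<Sum>j<k. a i j * y j) - \<xi> i\<bar> \<le> t"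
          using \<open>x \<in> U \<zeta> s\<close> \<open>y \<in> U \<xi> t\<close> i by (auto simp: U_def)
        then show ?thesis unfolding e by (simp add: abs_le_iff) argo
      qed
      then show ?thesis using z by (simp add: H_def U_def)
    qed
    then show "indicator (U \<zeta> s) x * indicator (U \<xi> t) y \<le> (indicator H z :: ennreal)\<^sup>2"
      by (cases "x \<in> U \<zeta> s"; cases "y \<in> U \<xi> t") simp_all
  qed (auto simp: H_def indicator_def)
  then have "emeasure P (U \<zeta> s) * emeasure P (U \<xi> t) \<le> (emeasure P H)\<^sup>2"
    by (simp add: H_def)
  then show "measure M {x \<in> space M. \<forall>i<n. \<bar>\<phi> i x - \<zeta> i\<bar> \<le> s} * measure M {x \<in> space M. \<forall>i<n. \<bar>\<phi> i x - \<xi> i\<bar> \<le> t}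
       \<le> (measure M {x \<in> space M. \<forall>i<n. \<bar>\<phi> i x - (\<zeta> i + \<xi> i) / 2\<bar> \<le> (s + t) / 2})\<^sup>2"
    unfolding H_def transfer_pos[symmetric]
    by (simp add: emeasure_eq_measure ennreal_power flip: ennreal_mult)
qed

subsection \<open>Norming functionals\<close>

definition sublinear :: "('a::real_vector \<Rightarrow> real) \<Rightarrow> bool" where
  "sublinear p \<longleftrightarrow> (\<forall>x y. p (x + y) \<le> p x + p y) \<and> (\<forall>t>0. \<forall>x. p (t *\<^sub>R x) = t * p x)"

lemma sublinear_zero: "sublinear p \<Longrightarrow> p 0 = 0"
proof -
  assume "sublinear p"
  then have "p (2 *\<^sub>R 0) = 2 * p 0" unfolding sublinear_def by (meson zero_less_numeral)
  then show "p 0 = 0" by simp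
qed

lemma sublinear_ge_minus: "sublinear p \<Longrightarrow> - p (- x) \<le> p x"
proof -
  assume p: "sublinear p"
  then have "p (x + - x) \<le> p x + p (- x)" unfolding sublinear_def by blast
  then show ?thesis using sublinear_zero[OF p] by simp
qed

text \<open>
  Pushes \<open>p\<close> down to a sublinear functional that is at most \<open>- p y\<close> at \<open>- y\<close>. A minimal
  sublinear functional is fixed by this operation for every \<open>y\<close>, hence additive.
\<close>

lemma sublinear_reduce:
  fixes p :: "'a::real_vector \<Rightarrow> real" and x y :: 'a
  assumes p: "sublinear p"
  defines "q \<equiv> \<lambda>x. INF t\<in>{0..}. p (x + t *\<^sub>R y) - t * p y"
  shows "sublinear q" and "q x \<le> p x" and "q (- y) \<le> - p y"
    and "t \<ge> 0 \<Longrightarrow> q x \<le> p (x + t *\<^sub>R y) - t * p y"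
proof -
  have add: "p (u + v) \<le> p u + p v" for u v using p by (auto simp: sublinear_def)
  have scale: "p (t *\<^sub>R u) = t * p u" if "t \<ge> 0" for t u
    using p that sublinear_zero[OF p] by (cases "t = 0") (auto simp: sublinear_def)
  have lb: "- p (- x) \<le> p (x + t *\<^sub>R y) - t * p y" if "t \<ge> 0" for x t
    using add[of "x + t *\<^sub>R y" "- x"] scale[OF that, of y] by simp
  have bdd: "bdd_below ((\<lambda>t. p (x + t *\<^sub>R y) - t * p y) ` {0..})" for x
    using lb by (intro bdd_belowI2[where m="- p (- x)"]) auto
  have le: "q x \<le> p (x + t *\<^sub>R y) - t * p y" if "t \<ge> 0" for x t
    unfolding q_def using that by (intro cINF_lower bdd) auto
  show "t \<ge> 0 \<Longrightarrow> q x \<le> p (x + t *\<^sub>R y) - t * p y" by (rule le)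
  show "q x \<le> p x" using le[of 0 x] by simp
  show "q (- y) \<le> - p y" using le[of 1 "- y"] sublinear_zero[OF p] by simp
  have ge: "c \<le> q x" if "\<And>t. t \<ge> 0 \<Longrightarrow> c \<le> p (x + t *\<^sub>R y) - t * p y" for c x
    unfolding q_def using that by (intro cINF_greatest) auto
  have "q (u + v) \<le> q u + q v" for u v
  proof -
    have 1: "q (u + v) \<le> (p (u + s *\<^sub>R y) - s * p y) + (p (v + t *\<^sub>R y) - t * p y)" if "s \<ge> 0" "t \<ge> 0" for s t
    proof -
      have "q (u + v) \<le> p (u + v + (s + t) *\<^sub>R y) - (s + t) * p y" using that by (intro le) auto
      also have "u + v + (s + t) *\<^sub>R y = (u + s *\<^sub>R y) + (v + t *\<^sub>R y)" by (simp add: algebra_simps)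
      finally show ?thesis using add[of "u + s *\<^sub>R y" "v + t *\<^sub>R y"] by (simp add: algebra_simps)
    qed
    \<comment> \<open>As \<open>s\<close> and \<open>t\<close> are independent, the infimum is taken
      over \<open>t\<close> with \<open>s\<close> fixed, and then over \<open>s\<close>.\<close>
    have "q (u + v) - (p (u + s *\<^sub>R y) - s * p y) \<le> q v" if "s \<ge> 0" for s
      using 1[OF that] by (intro ge) (simp add: algebra_simps)
    then have "q (u + v) - q v \<le> q u" by (intro ge) (smt (verit))
    then show ?thesis by simp
  qed
  moreover have "q (t *\<^sub>R x) = t * q x" if "t > 0" for t x
  proof -
    have half: "q (t *\<^sub>R x) \<le> t * q x" if "t > 0" for t x
    proof -
      have "q (t *\<^sub>R x) / t \<le> q x"
      proof (rule ge)
        fix s :: real assume s: "s \<ge> 0"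
        have "q (t *\<^sub>R x) \<le> p (t *\<^sub>R x + (t * s) *\<^sub>R y) - (t * s) * p y" using s that by (intro le) auto
        also have "t *\<^sub>R x + (t * s) *\<^sub>R y = t *\<^sub>R (x + s *\<^sub>R y)" by (simp add: scaleR_add_right)
        also have "p (t *\<^sub>R (x + s *\<^sub>R y)) = t * p (x + s *\<^sub>R y)" using that by (intro scale) auto
        finally show "q (t *\<^sub>R x) / t \<le> p (x + s *\<^sub>R y) - s * p y"
          using that by (simp add: field_simps)
      qed
      then show ?thesis using that by (simp add: field_simps)
    qed
    \<comment> \<open>The same inequality with factor \<open>1 / t\<close> at the point
      \<open>t *\<^sub>R x\<close> is the opposite one.\<close>
    have "q ((1 / t) *\<^sub>R (t *\<^sub>R x)) \<le> (1 / t) * q (t *\<^sub>R x)" using that by (intro half) auto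
    then have "t * q x \<le> q (t *\<^sub>R x)" using that by (simp add: field_simps)
    then show ?thesis using half[OF that, of x] by simp
  qed
  ultimately show "sublinear q" by (auto simp: sublinear_def)
qed

lemma sublinear_minimal_linear:
  fixes p :: "'a::real_vector \<Rightarrow> real"
  assumes p: "sublinear p" and min: "\<And>q. sublinear q \<Longrightarrow> q \<le> p \<Longrightarrow> q = p"
  shows "linear p"
proof -
  have add: "p (x + y) \<le> p x + p y" for x y using p by (auto simp: sublinear_def)
  have additive: "p (x + y) = p x + p y" for x y
  proof -
    define q where "q = (\<lambda>x. INF t\<in>{0..}. p (x + t *\<^sub>R y) - t * p y)"
    have "q = p" unfolding q_def
      by (intro min sublinear_reduce(1)[OF p] le_funI sublinear_reduce(2)[OF p])
    \<comment> \<open>The parameter value 1 in the infimum gives superadditivity once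
      \<open>q = p\<close>.\<close>
    moreover have "q x \<le> p (x + y) - p y"
      using sublinear_reduce(4)[OF p, where t=1 and x=x and y=y] by (simp add: q_def)
    ultimately show ?thesis using add[of x y] by simp
  qed
  have neg: "p (- x) = - p x" for x using additive[of x "- x"] sublinear_zero[OF p] by simp
  have "p (t *\<^sub>R x) = t * p x" for t x
  proof (cases t "0::real" rule: linorder_cases)
    case less
    then have "p ((- t) *\<^sub>R x) = (- t) * p x"
      using p unfolding sublinear_def by (meson neg_0_less_iff_less)
    then show ?thesis using neg[of "t *\<^sub>R x"] by simp
  qed (use p sublinear_zero[OF p] in \<open>auto simp: sublinear_def\<close>)
  then show ?thesis using additive by (intro linearI) auto
qed

text \<open>The pointwise infimum works. It is finite because each \<open>q x\<close> is at least
  \<open>- p0 (- x)\<close>, and it is subadditive because any two members of the chain have a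
  common minorant in the chain.\<close>

lemma sublinear_chain_lower_bound:
  fixes C :: "('a::real_vector \<Rightarrow> real) set"
  assumes ne: "C \<noteq> {}" and sub: "\<And>q. q \<in> C \<Longrightarrow> sublinear q \<and> q \<le> p0"
    and chain: "\<And>q q'. q \<in> C \<Longrightarrow> q' \<in> C \<Longrightarrow> q \<le> q' \<or> q' \<le> q"
  shows "\<exists>u. sublinear u \<and> u \<le> p0 \<and> (\<forall>q\<in>C. u \<le> q)"
proof -
  define u where "u x = (INF q\<in>C. q x)" for x
  have bdd: "bdd_below ((\<lambda>q. q x) ` C)" for x
  proof (rule bdd_belowI2)
    fix q assume "q \<in> C"
    then have "- q (- x) \<le> q x" "q (- x) \<le> p0 (- x)" using sub sublinear_ge_minus by (auto simp: le_fun_def)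
    then show "- p0 (- x) \<le> q x" by linarith
  qed
  have le: "u x \<le> q x" if "q \<in> C" for q x unfolding u_def by (intro cINF_lower bdd that)
  have ge: "c \<le> u x" if "\<And>q. q \<in> C \<Longrightarrow> c \<le> q x" for c x unfolding u_def by (intro cINF_greatest ne that)
  have "u (x + y) \<le> u x + u y" for x y
  proof -
    have 1: "u (x + y) \<le> q x + q' y" if q: "q \<in> C" "q' \<in> C" for q q'
    proof -
      obtain m where m: "m \<in> C" "m \<le> q" "m \<le> q'" using chain[OF q] q by blast
      have "u (x + y) \<le> m (x + y)" by (rule le[OF m(1)])
      also have "\<dots> \<le> m x + m y" using sub[OF m(1)] by (auto simp: sublinear_def)
      also have "\<dots> \<le> q x + q' y" using m by (intro add_mono) (auto simp: le_fun_def)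
      finally show ?thesis .
    qed
    have "u (x + y) - q x \<le> u y" if "q \<in> C" for q using 1[OF that] by (intro ge) (simp add: algebra_simps)
    then have "u (x + y) - u y \<le> u x" by (intro ge) (smt (verit))
    then show ?thesis by simp
  qed
  moreover have "u (t *\<^sub>R x) = t * u x" if "t > 0" for t x
  proof (rule antisym)
    have sc: "q (t *\<^sub>R x) = t * q x" if "q \<in> C" for q using sub[OF that] \<open>t > 0\<close> by (auto simp: sublinear_def)
    have "u (t *\<^sub>R x) / t \<le> u x"
      using le[of _ "t *\<^sub>R x"] sc that by (intro ge) (simp add: divide_le_eq mult.commute)
    then show "u (t *\<^sub>R x) \<le> t * u x" using that by (simp add: field_simps)
    show "t * u x \<le> u (t *\<^sub>R x)"
    proof (rule ge)
      fix q assume "q \<in> C"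
      then show "t * u x \<le> q (t *\<^sub>R x)" using le[of q x] sc[of q] that by simp
    qed
  qed
  moreover obtain q0 where "q0 \<in> C" using ne by auto
  then have "u \<le> p0" using le[of q0] sub[of q0] by (auto simp: le_fun_def intro: order_trans)
  ultimately show ?thesis using le by (intro exI[of _ u]) (auto simp: sublinear_def le_fun_def)
qed

text \<open>Hahn-Banach in the form of Zorn's lemma for the reversed pointwise order: a minimal
  sublinear functional below \<open>p0\<close> is linear.\<close>

lemma sublinear_dominates_linear:
  fixes p0 :: "'a::real_vector \<Rightarrow> real"
  assumes "sublinear p0"
  shows "\<exists>p. linear p \<and> p \<le> p0"
proof -
  define A where "A = {q. sublinear q \<and> q \<le> p0}"
  have "\<exists>m\<in>A. \<forall>a\<in>A. a \<le> m \<longrightarrow> a = m"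
  proof (rule predicate_Zorn)
    show "partial_order_on A (relation_of (\<lambda>x y. y \<le> x) A)"
      by (rule partial_order_on_relation_ofI) auto
    fix C assume C: "C \<in> Chains (relation_of (\<lambda>x y. y \<le> x) A)"
    then have CA: "C \<subseteq> A" and chain: "\<And>q q'. q \<in> C \<Longrightarrow> q' \<in> C \<Longrightarrow> q \<le> q' \<or> q' \<le> q"
      by (auto simp: Chains_def relation_of_def)
    show "\<exists>u\<in>A. \<forall>a\<in>C. u \<le> a"
    proof (cases "C = {}")
      case True then show ?thesis using assms by (auto simp: A_def)
    next
      case False
      from sublinear_chain_lower_bound[OF False _ chain, of p0] CA show ?thesis
        by (auto simp: A_def)
    qed
  qed
  then obtain m where m: "sublinear m" "m \<le> p0" "\<And>a. sublinear a \<Longrightarrow> a \<le> p0 \<Longrightarrow> a \<le> m \<Longrightarrow> a = m"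
    by (auto simp: A_def)
  then have "linear m" by (intro sublinear_minimal_linear) (auto intro: order_trans)
  then show ?thesis using m by blast
qed

text \<open>Reducing the norm in direction \<open>x0\<close> before looking for a linear minorant
  forces the value at \<open>- x0\<close> down to \<open>- norm x0\<close>; linearity and the bound
  by the norm then give equality at \<open>x0\<close>.\<close>

lemma norming_functional:
  fixes x0 :: "'a::real_normed_vector"
  shows "\<exists>\<phi>. bounded_linear \<phi> \<and> (\<forall>x. \<bar>\<phi> x\<bar> \<le> norm x) \<and> \<phi> x0 = norm x0"
proof -
  have n: "sublinear (norm :: 'a \<Rightarrow> real)" by (auto simp: sublinear_def norm_triangle_ineq)
  define p0 where "p0 = (\<lambda>x. INF t\<in>{0..}. norm (x + t *\<^sub>R x0) - t * norm x0)"
  have p0: "sublinear p0" "\<And>x. p0 x \<le> norm x" "p0 (- x0) \<le> - norm x0"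
    unfolding p0_def by (intro sublinear_reduce[OF n])+
  obtain p where p: "linear p" "p \<le> p0" using sublinear_dominates_linear[OF p0(1)] by blast
  interpret linear p by fact
  have le: "p x \<le> norm x" for x using p(2) p0(2)[of x] by (auto simp: le_fun_def intro: order_trans)
  have abs: "\<bar>p x\<bar> \<le> norm x" for x using le[of x] le[of "- x"] by (simp add: neg abs_le_iff)
  have "p (- x0) \<le> - norm x0" using p(2) p0(3) by (auto simp: le_fun_def intro: order_trans)
  then have "p x0 = norm x0" using le[of x0] by (simp add: neg)
  moreover have "bounded_linear p"
    by (rule bounded_linear_intro[where K=1]) (use abs in \<open>auto simp: add scale\<close>)
  ultimately show ?thesis using abs by blast
qed

text \<open>Norming functionals of a countable dense set suffice: if \<open>d\<close> is within
  \<open>e / 2\<close> of \<open>x\<close>, replacing \<open>x\<close> by \<open>d\<close> costs at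
  most \<open>e / 2\<close> in the norm and again at most \<open>e / 2\<close> in the
  functional.\<close>

lemma norming_sequence:
  shows "\<exists>\<phi> :: nat \<Rightarrow> 'a::{real_normed_vector, second_countable_topology} \<Rightarrow> real.
     (\<forall>i. bounded_linear (\<phi> i)) \<and> (\<forall>x s. norm x \<le> s \<longleftrightarrow> (\<forall>i. \<bar>\<phi> i x\<bar> \<le> s))"
proof -
  obtain D :: "'a set" where D: "countable D" "\<And>X. open X \<Longrightarrow> X \<noteq> {} \<Longrightarrow> \<exists>d\<in>D. d \<in> X"
    using countable_dense_setE by blast
  have "D \<noteq> {}" using D(2)[of UNIV] by auto
  obtain \<Phi> where \<Phi>: "\<And>d :: 'a. bounded_linear (\<Phi> d)" "\<And>d x. \<bar>\<Phi> d x\<bar> \<le> norm x" "\<And>d. \<Phi> d d = norm d"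
    using norming_functional by metis
  define \<phi> where "\<phi> i = \<Phi> (from_nat_into D i)" for i
  have "norm x \<le> s" if s: "\<forall>i. \<bar>\<phi> i x\<bar> \<le> s" for x s
  proof (rule field_le_epsilon)
    fix e :: real assume "e > 0"
    then obtain d where d: "d \<in> D" "d \<in> ball x (e / 2)" using D(2)[of "ball x (e / 2)"] by auto
    then have dx: "norm (d - x) < e / 2" by (simp add: dist_norm norm_minus_commute)
    obtain i where "from_nat_into D i = d" using d(1) D(1) by (metis from_nat_into_surj)
    then have "\<Phi> d x \<le> s" using s[rule_format, of i] by (simp add: \<phi>_def abs_le_iff)
    moreover have "\<Phi> d d = \<Phi> d x + \<Phi> d (d - x)"
      using bounded_linear.linear[OF \<Phi>(1), of d] by (simp add: linear_diff)
    moreover have "\<Phi> d (d - x) \<le> norm (d - x)" using \<Phi>(2)[of d "d - x"] by simp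
    moreover have "norm x \<le> norm d + norm (d - x)" using norm_triangle_ineq4[of d "d - x"] by simp
    ultimately show "norm x \<le> s + e" using \<Phi>(3)[of d] dx by linarith
  qed
  moreover have "\<bar>\<phi> i x\<bar> \<le> s" if "norm x \<le> s" for i x s
    using \<Phi>(2) that unfolding \<phi>_def by (meson order_trans)
  ultimately show ?thesis using \<Phi>(1) by (intro exI[of _ \<phi>]) (auto simp: \<phi>_def)
qed

subsection \<open>Balls and quantizers\<close>

lemma gaussian_cball:
  fixes M :: "'a::{real_normed_vector, second_countable_topology} measure"
  assumes M: "centered_gaussian M"
  shows gaussian_cball_log_concave: "measure M (cball x s) * measure M (cball y t)
      \<le> (measure M (cball ((1 / 2) *\<^sub>R (x + y)) ((s + t) / 2)))\<^sup>2"
    and gaussian_cball_symmetric: "measure M (cball (- x) s) = measure M (cball x s)"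
proof -
  interpret prob_space M using M by (simp add: centered_gaussian_def)
  have sp: "space M = UNIV" using M sets_eq_imp_space_eq[of M borel] by (simp add: centered_gaussian_def)
  obtain \<phi> :: "nat \<Rightarrow> 'a \<Rightarrow> real" where \<phi>: "\<And>i. bounded_linear (\<phi> i)"
    and nrm: "\<And>x s. norm x \<le> s \<longleftrightarrow> (\<forall>i. \<bar>\<phi> i x\<bar> \<le> s)"
    using norming_sequence by metis
  note [measurable] = centered_gaussian_measurable_functional[OF M \<phi>]
  have lin: "linear (\<phi> i)" for i using \<phi> by (rule bounded_linear.linear)
  define C where "C \<zeta> s n = {x \<in> space M. \<forall>i<n. \<bar>\<phi> i x - \<zeta> i\<bar> \<le> s}" for \<zeta> s n
  have lim: "(\<lambda>n. measure M (C (\<lambda>i. \<phi> i z) s n)) \<longlonglongrightarrow> measure M (cball z s)" for z s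
  proof -
    have "norm (x - z) \<le> s \<longleftrightarrow> (\<forall>i. \<bar>\<phi> i x - \<phi> i z\<bar> \<le> s)" for x
      unfolding nrm by (simp add: linear_diff[OF lin])
    moreover have "(\<forall>i. \<bar>\<phi> i x - \<phi> i z\<bar> \<le> s) \<longleftrightarrow> (\<forall>n. \<forall>i<n. \<bar>\<phi> i x - \<phi> i z\<bar> \<le> s)" for x
      by (metis lessI)
    ultimately have "cball z s = (\<Inter>n. C (\<lambda>i. \<phi> i z) s n)"
      by (simp add: set_eq_iff C_def sp dist_norm norm_minus_commute[of z])
    moreover have "(\<lambda>n. measure M (C (\<lambda>i. \<phi> i z) s n)) \<longlonglongrightarrow> measure M (\<Inter>n. C (\<lambda>i. \<phi> i z) s n)"
    proof (rule finite_Lim_measure_decseq)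
      show "range (C (\<lambda>i. \<phi> i z) s) \<subseteq> sets M" unfolding C_def by auto
      show "decseq (C (\<lambda>i. \<phi> i z) s)" by (auto simp: C_def decseq_def)
    qed
    ultimately show ?thesis by simp
  qed
  have mid: "\<phi> i ((1 / 2) *\<^sub>R (x + y)) = (\<phi> i x + \<phi> i y) / 2" for i
    by (simp add: linear_scale[OF lin] linear_add[OF lin])
  show "measure M (cball x s) * measure M (cball y t) \<le> (measure M (cball ((1 / 2) *\<^sub>R (x + y)) ((s + t) / 2)))\<^sup>2"
  proof (rule LIMSEQ_le)
    show "(\<lambda>n. measure M (C (\<lambda>i. \<phi> i x) s n) * measure M (C (\<lambda>i. \<phi> i y) t n)) \<longlonglongrightarrow> measure M (cball x s) * measure M (cball y t)"
      by (intro tendsto_mult lim)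
    show "(\<lambda>n. (measure M (C (\<lambda>i. (\<phi> i x + \<phi> i y) / 2) ((s + t) / 2) n))\<^sup>2) \<longlonglongrightarrow> (measure M (cball ((1 / 2) *\<^sub>R (x + y)) ((s + t) / 2)))\<^sup>2"
      unfolding mid[symmetric] by (intro tendsto_power lim)
    show "\<exists>N. \<forall>n\<ge>N. measure M (C (\<lambda>i. \<phi> i x) s n) * measure M (C (\<lambda>i. \<phi> i y) t n)
        \<le> (measure M (C (\<lambda>i. (\<phi> i x + \<phi> i y) / 2) ((s + t) / 2) n))\<^sup>2"
      unfolding C_def
      by (intro exI[of _ 0] allI impI centered_gaussian_cylinder_log_concave[OF M, where \<phi> = \<phi>, OF \<phi>])
  qed
  have "measure M (C (\<lambda>i. \<phi> i (- x)) s n) = measure M (C (\<lambda>i. \<phi> i x) s n)" for n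
    using centered_gaussian_cylinder_symmetric[OF M, where \<phi> = \<phi> and n = n and \<zeta> = "\<lambda>i. \<phi> i x" and s = s, OF \<phi>] by (simp add: C_def linear_neg[OF lin])
  then show "measure M (cball (- x) s) = measure M (cball x s)"
    using LIMSEQ_unique[OF lim[of "- x" s]] lim[of x s] by simp
qed

text \<open>The balls around \<open>x\<close> and \<open>- x\<close> have equal mass, and the
  midpoint of their centres is 0.\<close>

lemma gaussian_anderson_cball:
  fixes M :: "'a::{real_normed_vector, second_countable_topology} measure"
  assumes M: "centered_gaussian M"
  shows "measure M (cball x s) \<le> measure M (cball 0 s)"
proof (rule power2_le_imp_le)
  show "(measure M (cball x s))\<^sup>2 \<le> (measure M (cball 0 s))\<^sup>2"
    using gaussian_cball_log_concave[OF M, of x s "- x" s]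
    by (simp add: gaussian_cball_symmetric[OF M] power2_eq_square)
qed simp

lemma full_support_ball_pos:
  fixes M :: "'a::real_normed_vector measure"
  assumes "prob_space M" and supp: "measure_support M = UNIV" and s: "s > 0"
  shows "0 < measure M (ball 0 s)"
proof -
  interpret prob_space M by fact
  have "0 \<in> measure_support M" using supp by simp
  then have "0 < emeasure M (ball 0 s)" using s unfolding measure_support_def by (auto simp: open_ball)
  then show ?thesis by (simp add: emeasure_eq_measure)
qed

lemma full_support_cball_pos:
  fixes M :: "'a::real_normed_vector measure"
  assumes M: "prob_space M" "sets M = sets borel" and supp: "measure_support M = UNIV" and s: "s > 0"
  shows "0 < measure M (cball 0 s)"
proof -
  interpret prob_space M by fact
  have "0 < measure M (ball 0 s)" by (rule full_support_ball_pos[OF M(1) supp s])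
  also have "\<dots> \<le> measure M (cball 0 s)" using M(2) by (intro finite_measure_mono) auto
  finally show ?thesis .
qed

text \<open>
  Log-concavity at the radii \<open>s\<close> and \<open>s - 2 \<epsilon>\<close>, with \<open>\<epsilon>\<close> tending to 0, bounds
  \<open>\<mu>(cball 0 s) \<mu>(ball 0 s)\<close> by \<open>\<mu>(ball 0 s)\<^sup>2\<close>.
\<close>

lemma gaussian_sphere_null:
  fixes M :: "'a::{real_normed_vector, second_countable_topology} measure"
  assumes M: "centered_gaussian M" and supp: "measure_support M = UNIV" and s: "s > 0"
  shows "measure M (ball 0 s) = measure M (cball 0 s)"
proof -
  interpret prob_space M using M by (simp add: centered_gaussian_def)
  have sets: "sets M = sets borel" using M by (simp add: centered_gaussian_def)
  \<comment> \<open>The radius \<open>u 1 n\<close> is the midpoint of \<open>s\<close> and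
    \<open>u 2 n\<close>, and both sequences increase to \<open>s\<close> from strictly below, so
    their balls exhaust the open ball.\<close>
  define u where "u k n = s - k * (s / (real n + 2))" for k n
  have lim: "(\<lambda>n. measure M (cball 0 (u k n))) \<longlonglongrightarrow> measure M (ball 0 s)" if k: "k > 0" for k
  proof -
    have 1: "u k \<longlonglongrightarrow> s" unfolding u_def by real_asymp
    have "(\<Union>n. cball 0 (u k n)) = ball (0::'a) s"
    proof (intro equalityI subsetI)
      fix x :: 'a assume "x \<in> ball 0 s"
      then have "norm x < s" by simp
      then obtain n where "norm x < u k n"
        using order_tendstoD(1)[OF 1] by (auto simp: eventually_sequentially)
      then show "x \<in> (\<Union>n. cball 0 (u k n))" by (auto intro!: exI[of _ n])
    next
      fix x :: 'a assume "x \<in> (\<Union>n. cball 0 (u k n))"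
      then obtain n where "norm x \<le> u k n" by auto
      moreover have "u k n < s" using s k by (simp add: u_def)
      ultimately show "x \<in> ball 0 s" by simp
    qed
    moreover have "(\<lambda>n. measure M (cball 0 (u k n))) \<longlonglongrightarrow> measure M (\<Union>n. cball 0 (u k n))"
    proof (rule finite_Lim_measure_incseq)
      have "u k m \<le> u k n" if "m \<le> n" for m n
        using that s k unfolding u_def by (intro diff_left_mono mult_left_mono divide_left_mono) auto
      then show "incseq (\<lambda>n. cball (0::'a) (u k n))"
        unfolding incseq_def by (intro allI impI subset_cball)
    qed (auto simp: sets)
    ultimately show ?thesis by simp
  qed
  have "measure M (cball 0 s) * measure M (ball 0 s) \<le> (measure M (ball 0 s))\<^sup>2"
  proof (rule LIMSEQ_le)
    show "(\<lambda>n. measure M (cball 0 s) * measure M (cball 0 (u 2 n))) \<longlonglongrightarrow> measure M (cball 0 s) * measure M (ball 0 s)"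
      by (intro tendsto_mult tendsto_const lim) simp
    show "(\<lambda>n. (measure M (cball 0 (u 1 n)))\<^sup>2) \<longlonglongrightarrow> (measure M (ball 0 s))\<^sup>2"
      by (intro tendsto_power lim) simp
    have "(s + u 2 n) / 2 = u 1 n" for n by (simp add: u_def field_simps)
    then show "\<exists>N. \<forall>n\<ge>N. measure M (cball 0 s) * measure M (cball 0 (u 2 n)) \<le> (measure M (cball 0 (u 1 n)))\<^sup>2"
      using gaussian_cball_log_concave[OF M, of 0 s 0] by (metis add.right_neutral scaleR_zero_right)
  qed
  moreover have "0 < measure M (ball 0 s)"
    by (rule full_support_ball_pos[OF prob_space_axioms supp s])
  ultimately have "measure M (cball 0 s) \<le> measure M (ball 0 s)" by (simp add: power2_eq_square)
  moreover have "measure M (ball 0 s) \<le> measure M (cball 0 s)"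
    by (intro finite_measure_mono) (auto simp: sets)
  ultimately show ?thesis by simp
qed

text \<open>An intermediate value argument at the supremum of the radii whose ball has mass at most
  \<open>p\<close>. Closed balls are continuous from the right in the radius, which gives
  \<open>p \<le> m s\<close>; from the left they only exhaust the open ball, and the null sphere
  closes the gap.\<close>

lemma gaussian_cball_radius_exists:
  fixes M :: "'a::{real_normed_vector, second_countable_topology} measure"
  assumes M: "centered_gaussian M" and supp: "measure_support M = UNIV"
    and p: "p < 1" and s0: "s0 > 0" "measure M (cball 0 s0) \<le> p"
  shows "\<exists>s>0. measure M (cball 0 s) = p"
proof -
  interpret prob_space M using M by (simp add: centered_gaussian_def)
  have sets: "sets M = sets borel" using M by (simp add: centered_gaussian_def)
  then have sp: "space M = UNIV" using sets_eq_imp_space_eq[of M borel] by simp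
  define m where "m s = measure M (cball (0::'a) s)" for s
  have mono: "m s \<le> m t" if "s \<le> t" for s t
    unfolding m_def using that by (intro finite_measure_mono) (auto simp: sets)
  define S where "S = {s. 0 < s \<and> m s \<le> p}"
  have "s0 \<in> S" using s0 by (simp add: S_def m_def)
  have "\<exists>n. p < m (real n)"
  proof -
    have "(\<lambda>n. measure M (cball (0::'a) (real n))) \<longlonglongrightarrow> measure M (\<Union>n. cball (0::'a) (real n))"
      by (rule finite_Lim_measure_incseq) (auto simp: sets incseq_def)
    moreover have "(\<Union>n. cball (0::'a) (real n)) = UNIV" by (auto simp: real_arch_simple)
    ultimately have "(\<lambda>n. m (real n)) \<longlonglongrightarrow> 1" using prob_space by (simp add: m_def sp)
    from order_tendstoD(1)[OF this p] show ?thesis by (auto simp: eventually_sequentially)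
  qed
  then obtain n where n: "p < m (real n)" by blast
  have bdd: "bdd_above S"
  proof (rule bdd_aboveI)
    fix s assume "s \<in> S"
    then show "s \<le> real n" using n mono[of "real n" s] by (cases "real n \<le> s") (auto simp: S_def)
  qed
  define s where "s = Sup S"
  have "s0 \<le> s" unfolding s_def by (rule cSup_upper[OF \<open>s0 \<in> S\<close> bdd])
  then have s: "0 < s" using s0 by simp
  have low: "m t \<le> p" if t: "t < s" for t
  proof -
    obtain t' where "t' \<in> S" "t < t'" using less_cSupE[of t S] t \<open>s0 \<in> S\<close> by (auto simp: s_def)
    then show ?thesis using mono[of t t'] by (auto simp: S_def)
  qed
  have high: "p < m t" if "s < t" for t
  proof (rule ccontr)
    assume "\<not> p < m t"
    then have "t \<in> S" using that s by (simp add: S_def)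
    then show False using cSup_upper[OF _ bdd, of t] that by (simp add: s_def)
  qed
  have "p \<le> m s"
  proof (rule LIMSEQ_le_const)
    have "(\<lambda>n. measure M (cball (0::'a) (s + 1 / (real n + 1)))) \<longlonglongrightarrow> measure M (\<Inter>n. cball (0::'a) (s + 1 / (real n + 1)))"
    proof (rule finite_Lim_measure_decseq)
      show "decseq (\<lambda>n. cball (0::'a) (s + 1 / (real n + 1)))"
        unfolding decseq_def by (intro allI impI subset_cball add_left_mono divide_left_mono) auto
    qed (auto simp: sets)
    moreover have "(\<Inter>n. cball (0::'a) (s + 1 / (real n + 1))) = cball 0 s"
    proof (intro equalityI subsetI)
      fix x :: 'a assume x: "x \<in> (\<Inter>n. cball (0::'a) (s + 1 / (real n + 1)))"
      have "norm x \<le> s"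
      proof (rule LIMSEQ_le_const)
        show "(\<lambda>n. s + 1 / (real n + 1)) \<longlonglongrightarrow> s" by real_asymp
      qed (use x in auto)
      then show "x \<in> cball 0 s" by simp
    next
      fix x :: 'a assume "x \<in> cball 0 s"
      then show "x \<in> (\<Inter>n. cball (0::'a) (s + 1 / (real n + 1)))" by (auto intro: add_increasing2)
    qed
    ultimately show "(\<lambda>n. m (s + 1 / (real n + 1))) \<longlonglongrightarrow> m s" by (simp add: m_def)
    show "\<exists>N. \<forall>n\<ge>N. p \<le> m (s + 1 / (real n + 1))" by (intro exI[of _ 0] allI impI less_imp_le high) simp
  qed
  moreover have "m s \<le> p"
  proof -
    have "(\<lambda>n. measure M (cball (0::'a) (s - 1 / (real n + 1)))) \<longlonglongrightarrow> measure M (\<Union>n. cball (0::'a) (s - 1 / (real n + 1)))"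
    proof (rule finite_Lim_measure_incseq)
      show "incseq (\<lambda>n. cball (0::'a) (s - 1 / (real n + 1)))"
        unfolding incseq_def by (intro allI impI subset_cball diff_left_mono divide_left_mono) auto
    qed (auto simp: sets)
    moreover have "(\<Union>n. cball (0::'a) (s - 1 / (real n + 1))) = ball 0 s"
    proof (intro equalityI subsetI)
      fix x :: 'a assume "x \<in> ball 0 s"
      then have x: "norm x < s" by simp
      have "(\<lambda>n. s - 1 / (real n + 1)) \<longlonglongrightarrow> s" by real_asymp
      from order_tendstoD(1)[OF this x] obtain n where "norm x < s - 1 / (real n + 1)"
        by (auto simp: eventually_sequentially)
      then show "x \<in> (\<Union>n. cball (0::'a) (s - 1 / (real n + 1)))" by (auto intro!: exI[of _ n])
    next
      fix x :: 'a assume "x \<in> (\<Union>n. cball (0::'a) (s - 1 / (real n + 1)))"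
      then obtain n where "norm x \<le> s - 1 / (real n + 1)" by auto
      also have "\<dots> < s" by simp
      finally show "x \<in> ball 0 s" by simp
    qed
    ultimately have "(\<lambda>n. m (s - 1 / (real n + 1))) \<longlonglongrightarrow> m s"
      using gaussian_sphere_null[OF M supp s] by (simp add: m_def)
    then show ?thesis
      by (rule LIMSEQ_le_const2) (intro exI[of _ 0] allI impI low, simp)
  qed
  ultimately show ?thesis using s by (intro exI[of _ s]) (auto simp: m_def)
qed

section \<open>Two-sided bounds for the optimal distortion\<close>

lemma quantizer_uniform_exists:
  fixes e :: real
  assumes "e > 0"
  shows "\<exists>f :: 'a::{real_normed_vector, second_countable_topology} \<Rightarrow> 'a. f \<in> quantizers \<and> (\<forall>x. norm (x - f x) \<le> e)"
proof -
  obtain D :: "'a set" where D: "countable D" "\<And>X. open X \<Longrightarrow> X \<noteq> {} \<Longrightarrow> \<exists>d\<in>D. d \<in> X"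
    using countable_dense_setE by blast
  define d where "d = from_nat_into D"
  have ex: "\<exists>n. norm (x - d n) < e" for x
  proof -
    obtain y where "y \<in> D" "y \<in> ball x e" using D(2)[of "ball x e"] assms by auto
    moreover obtain n where "d n = y" using from_nat_into_surj[OF D(1) \<open>y \<in> D\<close>] by (auto simp: d_def)
    ultimately show ?thesis by (auto simp: dist_norm)
  qed
  \<comment> \<open>Choosing the first admissible index of the dense sequence makes the selection
    measurable.\<close>
  define N where "N x = (LEAST n. norm (x - d n) < e)" for x
  have N: "norm (x - d (N x)) < e" for x unfolding N_def by (rule LeastI_ex[OF ex])
  have Nm: "N \<in> measurable borel (count_space UNIV)"
    unfolding N_def by measurable
  have "(\<lambda>x. d (N x)) \<in> quantizers"
    unfolding quantizers_def
  proof (intro CollectI conjI)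
    show "(\<lambda>x. d (N x)) \<in> borel_measurable borel" by (rule measurable_compose[OF Nm]) simp
    show "countable (range (\<lambda>x. d (N x)))" by (rule countable_subset[of _ "range d"]) auto
  qed
  then show ?thesis using N by (intro exI[of _ "\<lambda>x. d (N x)"]) (auto intro: less_imp_le)
qed

lemma optimal_distortion_le:
  fixes M :: "'a::{real_normed_vector, second_countable_topology} measure"
  assumes "prob_space M" and sets: "sets M = sets borel" and r: "r > 0" and s: "s > 0"
    and ms: "measure M (cball 0 s) = exp (- R)"
  shows "optimal_distortion M r R \<le> ennreal (s powr r * exp (- R))"
proof (rule ennreal_le_epsilon)
  interpret prob_space M by fact
  have sp: "space M = UNIV" using sets_eq_imp_space_eq[OF sets] by simp
  fix e :: real assume e: "0 < e"
  \<comment> \<open>The accuracy is chosen so that its power \<open>r\<close> is \<open>e\<close>,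
    the slack allowed outside the ball.\<close>
  obtain f0 :: "'a \<Rightarrow> 'a" where f0: "f0 \<in> quantizers" "\<And>x. norm (x - f0 x) \<le> e powr (1 / r)"
    using quantizer_uniform_exists[of "e powr (1 / r)"] e by auto
  define f where "f x = (if norm x \<le> s then 0 else f0 x)" for x
  have [measurable]: "f0 \<in> borel_measurable borel" using f0 by (simp add: quantizers_def)
  have fm[measurable]: "f \<in> borel_measurable borel" unfolding f_def by measurable
  have "range f \<subseteq> insert 0 (range f0)" by (auto simp: f_def)
  then have fq: "f \<in> quantizers" using f0(1) fm countable_subset[of "range f" "insert 0 (range f0)"]
    by (simp add: quantizers_def)
  have vm: "f -` {z} \<in> sets M" for z using measurable_sets[OF fm, of "{z}"] by (simp add: sets)
  \<comment> \<open>Only an inequality: \<open>f0\<close> may also take the value 0, which enlarges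
    the cell and helps the entropy bound.\<close>
  have "exp (- R) \<le> measure M (f -` {0})"
    unfolding ms[symmetric] by (rule finite_measure_mono[OF _ vm]) (auto simp: f_def)
  also have "\<dots> \<le> (SUP z\<in>range f. measure M (f -` {z}))"
  proof (rule cSUP_upper)
    show "0 \<in> range f" using s by (intro range_eqI[of _ _ 0]) (simp add: f_def)
    show "bdd_above ((\<lambda>z. measure M (f -` {z})) ` range f)" by (intro bdd_aboveI2[where M=1] prob_le_1)
  qed
  finally have le: "exp (- R) \<le> (SUP z\<in>range f. measure M (f -` {z}))" .
  have "- R \<le> ln (SUP z\<in>range f. measure M (f -` {z}))"
    using le less_le_trans[OF exp_gt_zero le] by (subst ln_ge_iff)
  then have ent: "renyi_infinity_entropy M f \<le> R" by (simp add: renyi_infinity_entropy_def)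
  have pw: "norm (x - f x) powr r \<le> s powr r * indicator (cball 0 s) x + e" for x
  proof (cases "x \<in> cball 0 s")
    case True
    then have "norm (x - f x) powr r \<le> s powr r" using r by (intro powr_mono2) (auto simp: f_def)
    then show ?thesis using True e by simp
  next
    case False
    then have "norm (x - f x) powr r \<le> (e powr (1 / r)) powr r" using r f0(2)[of x] by (intro powr_mono2) (auto simp: f_def)
    then show ?thesis using False e r by (simp add: powr_powr)
  qed
  have "optimal_distortion M r R \<le> distortion M r f"
    unfolding optimal_distortion_def using fq ent by (intro INF_lower) auto
  also have "\<dots> \<le> (\<integral>\<^sup>+x. ennreal (s powr r * indicator (cball 0 s) x + e) \<partial>M)"
    unfolding distortion_def by (intro nn_integral_mono ennreal_leI pw)
  also have "\<dots> = (\<integral>\<^sup>+x. ennreal (s powr r) * indicator (cball 0 s) x + ennreal e \<partial>M)"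
    using e by (intro nn_integral_cong) (auto simp: indicator_def)
  also have "\<dots> = ennreal (s powr r) * emeasure M (cball 0 s) + ennreal e"
  proof -
    have cb: "cball 0 s \<in> sets M" by (simp add: sets)
    have "(\<integral>\<^sup>+x. ennreal (s powr r) * indicator (cball 0 s) x + ennreal e \<partial>M)
        = (\<integral>\<^sup>+x. ennreal (s powr r) * indicator (cball 0 s) x \<partial>M) + (\<integral>\<^sup>+x. ennreal e \<partial>M)"
      by (intro nn_integral_add borel_measurable_times_ennreal borel_measurable_indicator borel_measurable_const cb)
    then show ?thesis
      by (simp only: nn_integral_cmult_indicator[OF cb] nn_integral_const emeasure_space_1 mult_1_right)
  qed
  also have "\<dots> = ennreal (s powr r * exp (- R)) + ennreal e"
    by (simp add: emeasure_eq_measure ms ennreal_mult)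
  finally show "optimal_distortion M r R \<le> ennreal (s powr r * exp (- R)) + ennreal e" .
qed

text \<open>The largest cell is an actual cell \<open>A\<close>, of mass at least
  \<open>exp (- R)\<close>. Outside the ball of radius \<open>t\<close> around its quantization
  point every point of \<open>A\<close> costs at least \<open>t powr r\<close>. If the centred ball
  is heavier than \<open>exp (- R)\<close>, the left side is truncated to 0 by
  \<open>ennreal\<close>.\<close>

lemma gaussian_optimal_distortion_ge:
  fixes M :: "'a::{real_normed_vector, second_countable_topology} measure"
  assumes M: "centered_gaussian M" and r: "r > 0" and t: "t > 0"
  shows "ennreal (t powr r * (exp (- R) - measure M (cball 0 t))) \<le> optimal_distortion M r R"
  unfolding optimal_distortion_def
proof (rule INF_greatest)
  interpret prob_space M using M by (simp add: centered_gaussian_def)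
  have sets: "sets M = sets borel" using M by (simp add: centered_gaussian_def)
  fix f assume "f \<in> {f \<in> quantizers. renyi_infinity_entropy M f \<le> R}"
  then have f: "f \<in> quantizers" "renyi_infinity_entropy M f \<le> R" by auto
  then have [measurable]: "f \<in> borel_measurable borel" by (simp add: quantizers_def)
  obtain z where z: "0 < measure M (f -` {z})" "(SUP y\<in>range f. measure M (f -` {y})) = measure M (f -` {z})"
    using quantizer_SUP_attained[OF prob_space_axioms sets f(1)] by blast
  define A where "A = f -` {z}"
  have A: "A \<in> sets M" using measurable_sets[of f borel borel "{z}"] by (simp add: sets A_def)
  have "exp (- R) \<le> exp (ln (measure M A))"
    using f(2) z by (simp add: renyi_infinity_entropy_def A_def del: exp_ln)
  then have mA: "exp (- R) \<le> measure M A" using z by (simp add: A_def)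
  have B: "cball z t \<in> sets M" by (simp add: sets)
  have "exp (- R) - measure M (cball 0 t) \<le> measure M A - measure M (cball z t)"
    using mA gaussian_anderson_cball[OF M, of z t] by simp
  also have "\<dots> \<le> measure M (A - cball z t)"
  proof -
    have "measure M A \<le> measure M ((A - cball z t) \<union> cball z t)"
      using A B by (intro finite_measure_mono) auto
    also have "\<dots> \<le> measure M (A - cball z t) + measure M (cball z t)"
      using A B by (intro measure_Un_le) auto
    finally show ?thesis by simp
  qed
  finally have "ennreal (t powr r * (exp (- R) - measure M (cball 0 t))) \<le> ennreal (t powr r * measure M (A - cball z t))"
    by (intro ennreal_leI mult_left_mono) auto
  also have "\<dots> = (\<integral>\<^sup>+x. ennreal (t powr r) * indicator (A - cball z t) x \<partial>M)"
    using A B by (subst nn_integral_cmult_indicator) (auto simp: emeasure_eq_measure ennreal_mult)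
  also have "\<dots> \<le> distortion M r f"
    unfolding distortion_def
  proof (rule nn_integral_mono)
    fix x
    show "ennreal (t powr r) * indicator (A - cball z t) x \<le> ennreal (norm (x - f x) powr r)"
    proof (cases "x \<in> A - cball z t")
      case True
      then have "t \<le> norm (x - f x)" by (simp add: A_def dist_norm norm_minus_commute)
      then show ?thesis using True r t by (auto intro!: ennreal_leI powr_mono2)
    qed simp
  qed
  finally show "ennreal (t powr r * (exp (- R) - measure M (cball 0 t))) \<le> distortion M r f" .
qed

subsection \<open>Inversion of regularly varying asymptotics\<close>

lemma log_power_at_top:
  fixes a b c :: real
  assumes "c > 0" "a > 0"
  shows "filterlim (\<lambda>s. c * (1 / s) powr a * (ln (1 / s)) powr b) at_top (at_right 0)"
  using assms by real_asymp

text \<open>Regular variation at 0 with index \<open>- a\<close>: the logarithmic factor is slowly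
  varying and drops out of the ratio.\<close>

lemma log_power_scale:
  fixes a b c k :: real
  assumes "c > 0" "a > 0" "k > 0"
  shows "((\<lambda>s. (c * (1 / (k * s)) powr a * (ln (1 / (k * s))) powr b) /
     (c * (1 / s) powr a * (ln (1 / s)) powr b)) \<longlongrightarrow> k powr - a) (at_right 0)"
proof -
  have ev: "eventually (\<lambda>s::real. 0 < s \<and> s < 1 \<and> k * s < 1) (at_right 0)"
    by (intro eventually_conj) (use assms in real_asymp)+
  have "((\<lambda>s. ln (1 / (k * s)) / ln (1 / s)) \<longlongrightarrow> 1) (at_right 0)"
    using assms by real_asymp
  then have "((\<lambda>s. k powr - a * (ln (1 / (k * s)) / ln (1 / s)) powr b) \<longlongrightarrow> k powr - a * 1 powr b) (at_right 0)"
    by (intro tendsto_intros) auto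
  then have "((\<lambda>s. k powr - a * (ln (1 / (k * s)) / ln (1 / s)) powr b) \<longlongrightarrow> k powr - a) (at_right 0)"
    by simp
  then show ?thesis
  proof (rule Lim_transform_eventually)
    show "eventually (\<lambda>s. k powr - a * (ln (1 / (k * s)) / ln (1 / s)) powr b = 
       (c * (1 / (k * s)) powr a * (ln (1 / (k * s))) powr b) /
     (c * (1 / s) powr a * (ln (1 / s)) powr b)) (at_right 0)"
      using ev
    proof eventually_elim
      case (elim s)
      have L: "0 < ln (1 / s)" "0 < ln (1 / (k * s))" using elim assms by (auto intro!: ln_gt_zero)
      have "(1 / (k * s)) powr a = k powr - a * (1 / s) powr a"
        using elim assms by (simp add: powr_divide powr_mult powr_minus field_simps)
      then show ?case using L elim assms by (simp add: powr_divide field_simps)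
    qed
  qed
qed

text \<open>With \<open>R = f s\<close>, taking logarithms gives \<open>ln R\<close> asymptotic to
  \<open>a * ln (1 / s)\<close>. Substituting \<open>ln R / a\<close> for \<open>ln (1 / s)\<close>
  and solving for \<open>s\<close> produces the formula; the factor \<open>a powr (- b / a)\<close>
  comes from this substitution.\<close>

lemma log_power_asymp_inverse:
  fixes a b c :: real and f g :: "real \<Rightarrow> real"
  assumes pos: "c > 0" "a > 0"
    and f: "f \<sim>[at_right 0] (\<lambda>s. c * (1 / s) powr a * (ln (1 / s)) powr b)"
    and g: "filterlim g (at_right 0) at_top" and fg: "eventually (\<lambda>R. f (g R) = R) at_top"
  shows "g \<sim>[at_top] (\<lambda>R. c powr (1 / a) * a powr (- b / a) * R powr (- 1 / a) * (ln R) powr (b / a))"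
proof -
  define h where "h s = c * (1 / s) powr a * (ln (1 / s)) powr b" for s
  have hev: "eventually (\<lambda>s::real. 0 < s \<and> s < 1) (at_right 0)"
    by (intro eventually_conj) real_asymp+
  have hpos: "0 < h s" if "0 < s" "s < 1" for s
    using that pos by (auto simp: h_def intro!: mult_pos_pos ln_gt_zero)
  have lim1: "((\<lambda>s. f s / h s) \<longlongrightarrow> 1) (at_right 0)"
  proof (rule asymp_equivD_strong[OF f[folded h_def]])
    show "eventually (\<lambda>s. f s \<noteq> 0 \<or> h s \<noteq> 0) (at_right 0)"
      using hev
    proof eventually_elim
      case (elim s)
      then show ?case using hpos[of s] by simp
    qed
  qed
  have ev2: "eventually (\<lambda>s. 0 < f s / h s) (at_right 0)"
    using order_tendstoD(1)[OF lim1, of 0] by simp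
  have lnh: "((\<lambda>s. ln (h s) / ln (1 / s)) \<longlongrightarrow> a) (at_right 0)"
    unfolding h_def using pos by real_asymp
  have "((\<lambda>s. ln (f s / h s)) \<longlongrightarrow> ln 1) (at_right 0)"
    by (intro tendsto_ln lim1) simp
  moreover have "((\<lambda>s::real. inverse (ln (1 / s))) \<longlongrightarrow> 0) (at_right 0)" by real_asymp
  ultimately have "((\<lambda>s. ln (f s / h s) * inverse (ln (1 / s)) + ln (h s) / ln (1 / s)) \<longlongrightarrow> ln 1 * 0 + a) (at_right 0)"
    by (intro tendsto_add tendsto_mult lnh)
  then have "((\<lambda>s. ln (f s / h s) * inverse (ln (1 / s)) + ln (h s) / ln (1 / s)) \<longlongrightarrow> a) (at_right 0)" by simp
  then have lnf: "((\<lambda>s. ln (f s) / ln (1 / s)) \<longlongrightarrow> a) (at_right 0)"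
  proof (rule Lim_transform_eventually)
    show "eventually (\<lambda>s. ln (f s / h s) * inverse (ln (1 / s)) + ln (h s) / ln (1 / s) = ln (f s) / ln (1 / s)) (at_right 0)"
      using hev ev2
    proof eventually_elim
      case (elim s)
      then have "0 < h s" "0 < f s" using hpos[of s] by (auto simp: zero_less_divide_iff)
      then have "ln (f s) = ln (f s / h s) + ln (h s)" by (simp add: ln_div)
      then show ?case by (simp only: divide_inverse[symmetric] flip: add_divide_distrib)
    qed
  qed
  define T where "T R = c powr (1 / a) * a powr (- b / a) * R powr (- 1 / a) * (ln R) powr (b / a)" for R
  \<comment> \<open>Near 0 this product equals \<open>s / T (f s)\<close> exactly, so the two known
    limits settle the quotient.\<close>
  have "((\<lambda>s. (f s / h s) powr (1 / a) * (ln (f s) / ln (1 / s) / a) powr (- b / a)) \<longlongrightarrow> 1 powr (1 / a) * (a / a) powr (- b / a)) (at_right 0)"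
    using pos by (intro tendsto_intros lim1 lnf) auto
  then have "((\<lambda>s. (f s / h s) powr (1 / a) * (ln (f s) / ln (1 / s) / a) powr (- b / a)) \<longlongrightarrow> 1) (at_right 0)"
    using pos by simp
  moreover have "eventually (\<lambda>s. (f s / h s) powr (1 / a) * (ln (f s) / ln (1 / s) / a) powr (- b / a) = s / T (f s)) (at_right 0)"
    using hev ev2 order_tendstoD(1)[OF lnf \<open>a > 0\<close>]
  proof eventually_elim
    case (elim s)
    then have p: "0 < h s" "0 < f s" using hpos[of s] by (auto simp: zero_less_divide_iff)
    have L: "0 < ln (1 / s)" using elim by (auto intro!: ln_gt_zero)
    then have lf: "0 < ln (f s)" using elim by (simp add: zero_less_divide_iff)
    define x where "x = ln (1 / s)"
    define y where "y = ln (f s)"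
    have xy: "0 < x" "0 < y" using L lf by (auto simp: x_def y_def)
    have h: "h s powr (1 / a) = c powr (1 / a) * (1 / s) * x powr (b / a)"
      using elim pos xy by (simp add: h_def powr_mult powr_powr x_def)
    show ?case
      unfolding T_def x_def[symmetric] y_def[symmetric]
      using elim pos p xy by (simp add: powr_divide powr_mult powr_minus h powr_minus_divide field_simps)
  qed
  ultimately have "((\<lambda>s. s / T (f s)) \<longlongrightarrow> 1) (at_right 0)"
    by (rule Lim_transform_eventually)
  then have "((\<lambda>R. g R / T (f (g R))) \<longlongrightarrow> 1) at_top"
    by (rule filterlim_compose[OF _ g])
  moreover have "eventually (\<lambda>R. g R / T (f (g R)) = g R / T R) at_top"
    using fg by eventually_elim simp
  ultimately have "((\<lambda>R. g R / T R) \<longlongrightarrow> 1) at_top" by (rule Lim_transform_eventually)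
  then show ?thesis unfolding T_def by (rule asymp_equivI')
qed

subsection \<open>Distortion asymptotics\<close>

context
  fixes M :: "'a::{real_normed_vector, second_countable_topology} measure" and a b c :: real
  assumes M: "centered_gaussian M" and supp: "measure_support M = UNIV"
    and pos: "c > 0" "a > 0"
    and asymp: "small_ball M \<sim>[at_right 0] (\<lambda>s. c * (1 / s) powr a * (ln (1 / s)) powr b)"
begin

lemma exp_small_ball: "s > 0 \<Longrightarrow> exp (- small_ball M s) = measure M (cball 0 s)"
  using full_support_cball_pos[of M s] M supp by (simp add: small_ball_def centered_gaussian_def)

lemma small_ball_antimono: "0 < s \<Longrightarrow> s \<le> t \<Longrightarrow> small_ball M t \<le> small_ball M s"
proof -
  assume st: "0 < s" "s \<le> t"
  interpret prob_space M using M by (simp add: centered_gaussian_def)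
  have "measure M (cball 0 s) \<le> measure M (cball 0 t)"
    using M st by (intro finite_measure_mono subset_cball) (auto simp: centered_gaussian_def)
  then have "exp (- small_ball M s) \<le> exp (- small_ball M t)" using st by (simp add: exp_small_ball)
  then show ?thesis by simp
qed

lemma small_ball_at_top: "filterlim (small_ball M) at_top (at_right 0)"
  using asymp_equiv_at_top_transfer[OF asymp_equiv_symI[OF asymp] log_power_at_top[OF pos]] .

text \<open>\<open>inv_into\<close> is meaningful only on the image, so \<open>R\<close> must be
  attained. The blow-up of the small ball function at 0 supplies a ball of mass at most
  \<open>exp (- R)\<close>, from which a radius of exact mass is found.\<close>

lemma small_ball_inv_works:
  assumes "R > 0"
  shows "small_ball_inv M R > 0" "small_ball M (small_ball_inv M R) = R"
proof -
  have "eventually (\<lambda>s. 0 < s \<and> R \<le> small_ball M s) (at_right 0)"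
    using small_ball_at_top eventually_at_right_less[of 0] by (auto simp: filterlim_at_top eventually_conj_iff)
  then obtain s0 where s0: "0 < s0" "R \<le> small_ball M s0"
    using eventually_happens[of _ "at_right (0::real)"] by auto
  then have "measure M (cball 0 s0) \<le> exp (- R)" by (simp flip: exp_small_ball)
  then obtain s where s: "0 < s" "measure M (cball 0 s) = exp (- R)"
    using gaussian_cball_radius_exists[OF M supp _ s0(1), of "exp (- R)"] assms by auto
  then have "R = small_ball M s" by (simp add: small_ball_def)
  then have R: "R \<in> small_ball M ` {0<..}" using s by auto
  show "small_ball_inv M R > 0" "small_ball M (small_ball_inv M R) = R"
    using inv_into_into[OF R] f_inv_into_f[OF R] by (auto simp: small_ball_inv_def)
qed

lemma small_ball_inv_at_right: "filterlim (small_ball_inv M) (at_right 0) at_top"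
  unfolding filterlim_at
proof (intro conjI)
  show "eventually (\<lambda>R. small_ball_inv M R \<in> {0<..} \<and> small_ball_inv M R \<noteq> 0) at_top"
    using eventually_gt_at_top[of 0] by eventually_elim (use small_ball_inv_works in force)
  show "(small_ball_inv M \<longlongrightarrow> 0) at_top"
  proof (rule order_tendstoI)
    fix e :: real assume "e < 0"
    show "eventually (\<lambda>R. e < small_ball_inv M R) at_top"
      using eventually_gt_at_top[of 0]
    proof eventually_elim
      case (elim R)
      then show ?case using small_ball_inv_works(1)[of R] \<open>e < 0\<close> by simp
    qed
  next
    fix e :: real assume e: "0 < e"
    show "eventually (\<lambda>R. small_ball_inv M R < e) at_top"
      \<comment> \<open>An inverse value of at least \<open>e\<close> would force
        \<open>R \<le> small_ball M e\<close> by antitonicity.\<close>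
      using eventually_gt_at_top[of "max 0 (small_ball M e)"]
    proof eventually_elim
      case (elim R)
      then show ?case
        using small_ball_inv_works[of R] small_ball_antimono[OF e, of "small_ball_inv M R"] by force
    qed
  qed
qed

text \<open>
  Shrinking the radius by a fixed factor multiplies the small ball function by more than one,
  so the mass of the shrunken ball is negligible against \<^term>\<open>exp (- R)\<close>.
\<close>

lemma shrunken_ball_negligible:
  assumes k: "0 < k" "k < 1"
  shows "((\<lambda>R. measure M (cball 0 (k * small_ball_inv M R)) / exp (- R)) \<longlongrightarrow> 0) at_top"
proof -
  define h where "h s = c * (1 / s) powr a * (ln (1 / s)) powr b" for s
  have hev: "eventually (\<lambda>s. 0 < h s) (at_right 0)"
    using log_power_at_top[OF pos, of b] unfolding h_def by (simp add: filterlim_at_top_dense)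
  have lim1: "((\<lambda>s. small_ball M s / h s) \<longlongrightarrow> 1) (at_right 0)"
    by (rule asymp_equivD_strong[OF asymp[folded h_def]]) (use hev in \<open>auto elim!: eventually_mono\<close>)
  have scale: "filterlim (\<lambda>s. k * s) (at_right 0) (at_right 0)"
    using k by real_asymp
  have hev': "eventually (\<lambda>s. 0 < h (k * s)) (at_right 0)"
    by (rule eventually_compose_filterlim[OF hev scale])
  have "((\<lambda>s. (small_ball M (k * s) / h (k * s)) * (h (k * s) / h s) / (small_ball M s / h s)) \<longlongrightarrow> 1 * k powr - a / 1) (at_right 0)"
    using log_power_scale[OF pos k(1), of b]
    by (intro tendsto_divide tendsto_mult lim1 filterlim_compose[OF lim1 scale]) (auto simp: h_def)
  then have "((\<lambda>s. (small_ball M (k * s) / h (k * s)) * (h (k * s) / h s) / (small_ball M s / h s)) \<longlongrightarrow> k powr - a) (at_right 0)"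
    by simp
  then have "((\<lambda>s. small_ball M (k * s) / small_ball M s) \<longlongrightarrow> k powr - a) (at_right 0)"
  proof (rule Lim_transform_eventually)
    show "eventually (\<lambda>s. (small_ball M (k * s) / h (k * s)) * (h (k * s) / h s) / (small_ball M s / h s)
        = small_ball M (k * s) / small_ball M s) (at_right 0)"
      using hev hev' by eventually_elim simp
  qed
  then have lim: "((\<lambda>R. small_ball M (k * small_ball_inv M R) / small_ball M (small_ball_inv M R)) \<longlongrightarrow> k powr - a) at_top"
    by (rule filterlim_compose[OF _ small_ball_inv_at_right])
  have "1 < k powr - a"
    using k pos powr_less_mono'[of k "- a" 0] by simp
  \<comment> \<open>The lower gap turns the limit into the eventual bound \<open>q * R\<close>; the
    upper gap \<open>q - 1\<close> is the exponential rate at which the mass ratio decays.\<close>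
  then obtain q where q: "1 < q" "q < k powr - a" using dense by blast
  have "eventually (\<lambda>R. q * R \<le> small_ball M (k * small_ball_inv M R)) at_top"
    using order_tendstoD(1)[OF lim q(2)] eventually_gt_at_top[of 0]
  proof eventually_elim
    case (elim R)
    then show ?case using small_ball_inv_works(2)[of R] by (simp add: field_simps)
  qed
  then have up: "eventually (\<lambda>R. measure M (cball 0 (k * small_ball_inv M R)) / exp (- R) \<le> exp ((1 - q) * R)) at_top"
    using eventually_gt_at_top[of 0]
  proof eventually_elim
    case (elim R)
    have "0 < k * small_ball_inv M R" using elim k small_ball_inv_works(1)[of R] by simp
    then have "measure M (cball 0 (k * small_ball_inv M R)) = exp (- small_ball M (k * small_ball_inv M R))"
      by (simp add: exp_small_ball)
    also have "\<dots> / exp (- R) = exp (R - small_ball M (k * small_ball_inv M R))"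
      by (simp flip: exp_diff)
    finally show ?case using elim by (simp add: algebra_simps)
  qed
  have "((\<lambda>R. exp ((1 - q) * R)) \<longlongrightarrow> 0) at_top" using q by real_asymp
  with up show ?thesis
    by (intro tendsto_sandwich[OF _ up tendsto_const]) auto
qed

text \<open>The ratio is at most 1 for every \<open>R > 0\<close>, and for fixed
  \<open>k < 1\<close> it has an eventual lower bound tending to \<open>k powr r\<close>. Given
  \<open>y < 1\<close>, some such \<open>k\<close> has \<open>y < k powr r\<close>.\<close>

lemma optimal_distortion_asymp:
  assumes r: "r > 0"
  shows "(\<lambda>R. enn2real (optimal_distortion M r R)) \<sim>[at_top] (\<lambda>R. small_ball_inv M R powr r * exp (- R))"
proof (rule asymp_equivI')
  interpret prob_space M using M by (simp add: centered_gaussian_def)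
  define s where "s = small_ball_inv M"
  define D where "D R = optimal_distortion M r R" for R
  define E where "E R = s R powr r * exp (- R)" for R
  have s: "0 < s R" "measure M (cball 0 (s R)) = exp (- R)" if "R > 0" for R
    using small_ball_inv_works[OF that] exp_small_ball[of "s R"] by (auto simp: s_def)
  have up: "D R \<le> ennreal (E R)" if "R > 0" for R
    unfolding D_def E_def using M r s[OF that]
    by (intro optimal_distortion_le) (auto simp: centered_gaussian_def prob_space_axioms)
  have E: "0 < E R" if "R > 0" for R using s[OF that] by (simp add: E_def)
  \<comment> \<open>\<open>enn2real\<close> sends infinity to 0, so finiteness is secured before the
    lower bound is moved to the reals.\<close>
  have fin: "ennreal (enn2real (D R)) = D R" if "R > 0" for R
    using up[OF that] by (metis ennreal_enn2real ennreal_less_top order_le_less_trans)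
  have le1: "enn2real (D R) / E R \<le> 1" if "R > 0" for R
    using enn2real_leI[OF _ up[OF that]] E[OF that] by simp
  have low: "k powr r * (1 - measure M (cball 0 (k * s R)) / exp (- R)) \<le> enn2real (D R) / E R"
    if "R > 0" "k > 0" for R k
  proof -
    have "ennreal ((k * s R) powr r * (exp (- R) - measure M (cball 0 (k * s R)))) \<le> D R"
      unfolding D_def using M r that s[OF that(1)]
      by (intro gaussian_optimal_distortion_ge) auto
    also have "D R = ennreal (enn2real (D R))" using fin[OF that(1)] by simp
    finally have "(k * s R) powr r * (exp (- R) - measure M (cball 0 (k * s R))) \<le> enn2real (D R)"
      by (simp add: ennreal_le_iff)
    moreover have "(k * s R) powr r * (exp (- R) - measure M (cball 0 (k * s R)))
        = k powr r * (1 - measure M (cball 0 (k * s R)) / exp (- R)) * E R"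
      using that s[OF that(1)] by (simp add: E_def powr_mult field_simps)
    ultimately show ?thesis using E[OF that(1)] by (simp add: pos_le_divide_eq)
  qed
  have "((\<lambda>R. enn2real (D R) / E R) \<longlongrightarrow> 1) at_top"
  proof (rule order_tendstoI)
    fix y :: real assume y: "1 < y"
    show "eventually (\<lambda>R. enn2real (D R) / E R < y) at_top"
      using eventually_gt_at_top[of 0] by eventually_elim (use le1 y in \<open>auto intro: le_less_trans\<close>)
  next
    fix y :: real assume y: "y < 1"
    have "((\<lambda>k. k powr r) \<longlongrightarrow> 1) (at_left (1::real))" by real_asymp
    from order_tendstoD(1)[OF this y] have "eventually (\<lambda>k. y < k powr r \<and> 0 < k \<and> k < 1) (at_left (1::real))"
      using eventually_at_left_real[OF zero_less_one] by eventually_elim auto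
    then obtain k where k: "y < k powr r" "0 < k" "k < 1"
      using eventually_happens[of _ "at_left (1::real)"] by auto
    have "((\<lambda>R. k powr r * (1 - measure M (cball 0 (k * s R)) / exp (- R))) \<longlongrightarrow> k powr r * (1 - 0)) at_top"
      unfolding s_def by (intro tendsto_intros shrunken_ball_negligible k)
    then have "eventually (\<lambda>R. y < k powr r * (1 - measure M (cball 0 (k * s R)) / exp (- R))) at_top"
      using k by (intro order_tendstoD(1)[where y="k powr r * (1 - 0)"]) auto
    then show "eventually (\<lambda>R. y < enn2real (D R) / E R) at_top"
      using eventually_gt_at_top[of 0] by eventually_elim (use low k in \<open>auto intro: less_le_trans\<close>)
  qed
  then show "((\<lambda>R. enn2real (optimal_distortion M r R) / (small_ball_inv M R powr r * exp (- R))) \<longlongrightarrow> 1) at_top"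
    by (simp add: D_def E_def s_def)
qed

lemma small_ball_inv_asymp:
  "small_ball_inv M \<sim>[at_top] (\<lambda>R. c powr (1 / a) * a powr (- b / a) * R powr (- 1 / a) * (ln R) powr (b / a))"
proof (rule log_power_asymp_inverse[OF pos asymp small_ball_inv_at_right])
  show "eventually (\<lambda>R. small_ball M (small_ball_inv M R) = R) at_top"
    using eventually_gt_at_top[of 0] by eventually_elim (rule small_ball_inv_works)
qed

end

theorem corollary3p12:
  fixes M :: "'a::{banach, second_countable_topology} measure"
    and r c a b :: real
  assumes infinite_dim: "\<not> (\<exists>B :: 'a set. finite B \<and> span B = UNIV)"
    and gaussian: "centered_gaussian M"
    and nonatomic: "non_atomic M"
    and full_support: "measure_support M = UNIV"
    and "r > 0" and "c > 0" and "a > 0"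
    and small_ball_asymp:
      "small_ball M \<sim>[at_right 0] (\<lambda>s. c * (1 / s) powr a * (ln (1 / s)) powr b)"
  shows "((\<lambda>R. enn2real (optimal_distortion M r R))
            \<sim>[at_top] (\<lambda>R. small_ball_inv M R powr r * exp (- R))) \<and>
         ((\<lambda>R. small_ball_inv M R powr r * exp (- R))
            \<sim>[at_top] (\<lambda>R. (c powr (1 / a) * a powr (- b / a) * R powr (- 1 / a)
                              * (ln R) powr (b / a)) powr r * exp (- R)))"
proof
  note ctx = gaussian full_support \<open>c > 0\<close> \<open>a > 0\<close> small_ball_asymp
  show "(\<lambda>R. enn2real (optimal_distortion M r R)) \<sim>[at_top] (\<lambda>R. small_ball_inv M R powr r * exp (- R))"
    using ctx \<open>r > 0\<close> by (rule optimal_distortion_asymp)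
  \<comment> \<open>Eventual nonnegativity of both sides is what allows raising the asymptotic
    equivalence to the real power \<open>r\<close>.\<close>
  have "eventually (\<lambda>R. small_ball_inv M R \<ge> 0) at_top"
    using eventually_gt_at_top[of 0] by eventually_elim (rule less_imp_le[OF small_ball_inv_works(1)[OF ctx]])
  moreover have "eventually (\<lambda>R. c powr (1 / a) * a powr (- b / a) * R powr (- 1 / a) * (ln R) powr (b / a) \<ge> 0) at_top"
    by simp
  ultimately show "(\<lambda>R. small_ball_inv M R powr r * exp (- R))
            \<sim>[at_top] (\<lambda>R. (c powr (1 / a) * a powr (- b / a) * R powr (- 1 / a)
                              * (ln R) powr (b / a)) powr r * exp (- R))"
    by (intro asymp_equiv_mult asymp_equiv_refl asymp_equiv_powr_real small_ball_inv_asymp[OF ctx])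
qed

end
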